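(* Let $k$ be any field with algebraic closure $\bar{k}$, let $A$ be a commutative $k$-algebra, and let $\sigma$ be a nontrivial exponential map on $A$ over $k$. Set $\bar{A}:=\bar{k}\otimes_k A$ and $\bar{\sigma}:=\mathrm{id}_{\bar{k}}\otimes\sigma$, which is an exponential map on $\bar{A}$ over $\bar{k}$, and regard $A$ as a subring of $\bar{A}$. Let $s\in A$ be a minimal local slice of $\bar{\sigma}$. Assume that $\operatorname{lc}_\sigma(s)$ is a nonzero divisor of $\bar{A}$ and can be written as $\operatorname{lc}_\sigma(s)=p_1\cdots p_l$ with $l\ge 0$, where $p_1,\ldots,p_l\in\bar{A}^{\bar{\sigma}}$ are such that $\bar{A}^{\bar{\sigma}}/p_i\bar{A}^{\bar{\sigma}}=\bar{k}$ and $\bar{A}/p_i\bar{A}$ is a domain for $i=1,\ldots,l$. Then $A$ is the polynomial ring in $s$ over $A^\sigma$.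
   Context: Let $B$ be a commutative ring with identity and $B[x]$ the polynomial ring in one variable. A ring homomorphism $\tau:B\to B[x]$ is an exponential map on $B$ if for each $b\in B$, writing $\tau(b)=\sum_{i=0}^m b_ix^i$ with $b_i\in B$: (E1) $b_0=b$; (E2) $\sum_{i=0}^m\tau(b_i)y^i=\sum_{i=0}^m b_i(x+y)^i$ in $B[x,y]$, where $y$ is a new variable. The ring of $\tau$-invariants is $B^\tau:=\{b\in B\mid \tau(b)=b\}$. $\tau$ is nontrivial if $B^\tau\ne B$. For a subring $R$ of $B$, $\tau$ is an exponential map over $R$ if $R\subset B^\tau$ (for a $k$-algebra, "over $k$" means that the image of $k$ lies in $B^\tau$). For $b\in B$, $\deg_\tau(b)$ and $\operatorname{lc}_\tau(b)$ denote the degree and the leading coefficient of $\tau(b)$ as a polynomial in $x$ over $B$; one has $\operatorname{lc}_\tau(b)\in B^\tau$. Assume $\tau$ is nontrivial. An element $s\in B$ is a local slice of $\tau$ if $\deg_\tau(s)$ equals the minimum of $\deg_\tau(b)$ over $b\in B\setminus B^\tau$. The plinth ideal is $\operatorname{pl}(\tau):=\{\operatorname{lc}_\tau(s)\mid s\in B \text{ is a local slice of }\tau\}\cup\{0\}$, which is an ideal of $B^\tau$. A local slice $s$ of $\tau$ is minimal if there is no $a\in\operatorname{pl}(\tau)$ with $\operatorname{lc}_\tau(s)B^\tau\subsetneqq aB^\tau$. These notions are applied to $(B,\tau)=(A,\sigma)$ and to $(B,\tau)=(\bar{A},\bar{\sigma})$, where $\bar A[x]$ is identified with $\bar k\otimes_k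 A[x]$; one has $\bar{A}^{\bar{\sigma}}=\bar{k}\otimes_k A^\sigma$. For $s\in A$, $\operatorname{lc}_\sigma(s)\in A^\sigma$ is identified with its image in $\bar{A}$, which equals $\operatorname{lc}_{\bar{\sigma}}(s)$. The condition $\bar{A}^{\bar{\sigma}}/p_i\bar{A}^{\bar{\sigma}}=\bar{k}$ means that the natural map $\bar{k}\to\bar{A}^{\bar{\sigma}}/p_i\bar{A}^{\bar{\sigma}}$ is an isomorphism. An empty product ($l=0$) equals $1$. "$A$ is the polynomial ring in $s$ over $A^\sigma$" means that $A=A^\sigma[s]$ and $s$ is algebraically independent over $A^\sigma$. *)

theory Defs
  imports "HOL-Algebra.Algebra" "HOL-Library.Poly_Mapping"
begin

section \<open>Exponential maps\<close>

text \<open>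
  \<^term>\<open>UP B\<close> plays the role of \<open>B[x]\<close>, and \<^term>\<open>UP (UP B)\<close> that of \<open>B[x,y] = B[x][y]\<close>: the inner
  variable is \<open>x\<close> and the outer one is \<open>y\<close>.
\<close>

definition UP2_x :: "('b, 'm) ring_scheme \<Rightarrow> nat \<Rightarrow> nat \<Rightarrow> 'b" where
  "UP2_x B = monom (UP (UP B)) (monom (UP B) \<one>\<^bsub>B\<^esub> 1) 0"

definition UP2_y :: "('b, 'm) ring_scheme \<Rightarrow> nat \<Rightarrow> nat \<Rightarrow> 'b" where
  "UP2_y B = monom (UP (UP B)) \<one>\<^bsub>UP B\<^esub> 1"

definition UP2_const :: "('b, 'm) ring_scheme \<Rightarrow> 'b \<Rightarrow> nat \<Rightarrow> nat \<Rightarrow> 'b" where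
  "UP2_const B b = monom (UP (UP B)) (monom (UP B) b 0) 0"

definition exponential_map :: "('b, 'm) ring_scheme \<Rightarrow> ('b \<Rightarrow> nat \<Rightarrow> 'b) \<Rightarrow> bool" where
  "exponential_map B \<tau> \<longleftrightarrow>
     \<tau> \<in> ring_hom B (UP B) \<and>
     (\<forall>b\<in>carrier B. coeff (UP B) (\<tau> b) 0 = b) \<and>
     (\<forall>b\<in>carrier B.
        (\<Oplus>\<^bsub>UP (UP B)\<^esub>i\<in>{..deg B (\<tau> b)}.
           monom (UP (UP B)) (\<tau> (coeff (UP B) (\<tau> b) i)) 0 \<otimes>\<^bsub>UP (UP B)\<^esub> UP2_y B [^]\<^bsub>UP (UP B)\<^esub> i) =
        (\<Oplus>\<^bsub>UP (UP B)\<^esub>i\<in>{..deg B (\<tau> b)}.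
           UP2_const B (coeff (UP B) (\<tau> b) i) \<otimes>\<^bsub>UP (UP B)\<^esub>
             (UP2_x B \<oplus>\<^bsub>UP (UP B)\<^esub> UP2_y B) [^]\<^bsub>UP (UP B)\<^esub> i))"

definition exp_invariants :: "('b, 'm) ring_scheme \<Rightarrow> ('b \<Rightarrow> nat \<Rightarrow> 'b) \<Rightarrow> 'b set" where
  "exp_invariants B \<tau> = {b \<in> carrier B. \<tau> b = monom (UP B) b 0}"

abbreviation invariant_ring ::
  "('b, 'm) ring_scheme \<Rightarrow> ('b \<Rightarrow> nat \<Rightarrow> 'b) \<Rightarrow> ('b, 'm) ring_scheme" where
  "invariant_ring B \<tau> \<equiv> B\<lparr>carrier := exp_invariants B \<tau>\<rparr>"

definition nontrivial_exponential_map :: "('b, 'm) ring_scheme \<Rightarrow> ('b \<Rightarrow> nat \<Rightarrow> 'b) \<Rightarrow> bool" where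
  "nontrivial_exponential_map B \<tau> \<longleftrightarrow> exponential_map B \<tau> \<and> exp_invariants B \<tau> \<noteq> carrier B"

definition exponential_map_over ::
  "('b, 'm) ring_scheme \<Rightarrow> ('b \<Rightarrow> nat \<Rightarrow> 'b) \<Rightarrow> 'b set \<Rightarrow> bool" where
  "exponential_map_over B \<tau> R \<longleftrightarrow> exponential_map B \<tau> \<and> R \<subseteq> exp_invariants B \<tau>"

definition exp_deg :: "('b, 'm) ring_scheme \<Rightarrow> ('b \<Rightarrow> nat \<Rightarrow> 'b) \<Rightarrow> 'b \<Rightarrow> nat" where
  "exp_deg B \<tau> b = deg B (\<tau> b)"

definition exp_lc :: "('b, 'm) ring_scheme \<Rightarrow> ('b \<Rightarrow> nat \<Rightarrow> 'b) \<Rightarrow> 'b \<Rightarrow> 'b" where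
  "exp_lc B \<tau> b = coeff (UP B) (\<tau> b) (deg B (\<tau> b))"

definition local_slice :: "('b, 'm) ring_scheme \<Rightarrow> ('b \<Rightarrow> nat \<Rightarrow> 'b) \<Rightarrow> 'b \<Rightarrow> bool" where
  "local_slice B \<tau> s \<longleftrightarrow> s \<in> carrier B \<and>
     (\<exists>b \<in> carrier B - exp_invariants B \<tau>. exp_deg B \<tau> s = exp_deg B \<tau> b) \<and>
     (\<forall>b \<in> carrier B - exp_invariants B \<tau>. exp_deg B \<tau> s \<le> exp_deg B \<tau> b)"

definition plinth_ideal :: "('b, 'm) ring_scheme \<Rightarrow> ('b \<Rightarrow> nat \<Rightarrow> 'b) \<Rightarrow> 'b set" where
  "plinth_ideal B \<tau> = {exp_lc B \<tau> s | s. local_slice B \<tau> s} \<union> {\<zero>\<^bsub>B\<^esub>}"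

definition minimal_local_slice :: "('b, 'm) ring_scheme \<Rightarrow> ('b \<Rightarrow> nat \<Rightarrow> 'b) \<Rightarrow> 'b \<Rightarrow> bool" where
  "minimal_local_slice B \<tau> s \<longleftrightarrow> local_slice B \<tau> s \<and>
     \<not> (\<exists>a \<in> plinth_ideal B \<tau>.
          PIdl\<^bsub>invariant_ring B \<tau>\<^esub> (exp_lc B \<tau> s) \<subset> PIdl\<^bsub>invariant_ring B \<tau>\<^esub> a)"

section \<open>Polynomial rings inside a ring\<close>

definition nonzero_divisor :: "('b, 'm) ring_scheme \<Rightarrow> 'b \<Rightarrow> bool" where
  "nonzero_divisor B c \<longleftrightarrow> c \<in> carrier B \<and>
     (\<forall>b \<in> carrier B. c \<otimes>\<^bsub>B\<^esub> b = \<zero>\<^bsub>B\<^esub> \<longrightarrow> b = \<zero>\<^bsub>B\<^esub>)"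

text \<open>\<^term>\<open>ring.simple_extension B R s\<close> is \<open>R[s]\<close>, the set of values at \<open>s\<close> of polynomials over \<open>R\<close>.\<close>

definition is_polynomial_ring_in :: "('b, 'm) ring_scheme \<Rightarrow> 'b set \<Rightarrow> 'b \<Rightarrow> bool" where
  "is_polynomial_ring_in B R s \<longleftrightarrow> s \<in> carrier B \<and>
     ring.simple_extension B R s = carrier B \<and> ring.transcendental B R s"

section \<open>Base change of an algebra\<close>

text \<open>
  For a \<open>K\<close>-algebra \<open>A\<close> and an extension \<open>L\<close> of \<open>K\<close>, the ring \<open>L \<otimes>\<^sub>K A\<close> is the free abelian group on
  \<open>L \<times> A\<close> modulo the relations expressing biadditivity and \<open>K\<close>-balancedness. The group is given the
  multiplication \<open>(l, a)(l', a') = (ll', aa')\<close>, extended biadditively. A basis element times a relation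
  is again a relation, so the subgroup generated by the relations coincides with the ideal they
  generate.
\<close>

definition pair_ring ::
  "('l, 'm) ring_scheme \<Rightarrow> ('a, 'n) ring_scheme \<Rightarrow> ('l \<times> 'a \<Rightarrow>\<^sub>0 int) ring" where
  "pair_ring L A =
     \<lparr>carrier = {u. Poly_Mapping.keys u \<subseteq> carrier L \<times> carrier A},
      monoid.mult = (\<lambda>u v. frag_extend (\<lambda>(l, a). frag_extend (\<lambda>(l', a').
                frag_of (l \<otimes>\<^bsub>L\<^esub> l', a \<otimes>\<^bsub>A\<^esub> a')) v) u),
      one = frag_of (\<one>\<^bsub>L\<^esub>, \<one>\<^bsub>A\<^esub>),
      ring.zero = 0,
      add = (+)\<rparr>"

definition tensor_relations ::
  "('l, 'm) ring_scheme \<Rightarrow> 'l set \<Rightarrow> ('l, 'a, 'n) module_scheme \<Rightarrow> ('l \<times> 'a \<Rightarrow>\<^sub>0 int) set" where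
  "tensor_relations L K A =
     {frag_of (l \<oplus>\<^bsub>L\<^esub> l', a) - frag_of (l, a) - frag_of (l', a) | l l' a.
        l \<in> carrier L \<and> l' \<in> carrier L \<and> a \<in> carrier A} \<union>
     {frag_of (l, a \<oplus>\<^bsub>A\<^esub> a') - frag_of (l, a) - frag_of (l, a') | l a a'.
        l \<in> carrier L \<and> a \<in> carrier A \<and> a' \<in> carrier A} \<union>
     {frag_of (l \<otimes>\<^bsub>L\<^esub> c, a) - frag_of (l, c \<odot>\<^bsub>A\<^esub> a) | l c a.
        l \<in> carrier L \<and> c \<in> K \<and> a \<in> carrier A}"

definition tensor_ideal ::
  "('l, 'm) ring_scheme \<Rightarrow> 'l set \<Rightarrow> ('l, 'a, 'n) module_scheme \<Rightarrow> ('l \<times> 'a \<Rightarrow>\<^sub>0 int) set" where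
  "tensor_ideal L K A = Idl\<^bsub>pair_ring L A\<^esub> (tensor_relations L K A)"

definition base_change ::
  "('l, 'm) ring_scheme \<Rightarrow> 'l set \<Rightarrow> ('l, 'a, 'n) module_scheme \<Rightarrow> ('l \<times> 'a \<Rightarrow>\<^sub>0 int) set ring" where
  "base_change L K A = pair_ring L A Quot tensor_ideal L K A"

definition pure_tensor ::
  "('l, 'm) ring_scheme \<Rightarrow> 'l set \<Rightarrow> ('l, 'a, 'n) module_scheme \<Rightarrow> 'l \<Rightarrow> 'a \<Rightarrow>
     ('l \<times> 'a \<Rightarrow>\<^sub>0 int) set" where
  "pure_tensor L K A l a = tensor_ideal L K A +>\<^bsub>pair_ring L A\<^esub> frag_of (l, a)"

text \<open>
  For a \<open>K\<close>-linear \<open>f : A \<rightarrow> A\<close>, this is \<open>id\<^sub>L \<otimes> f\<close>. The union ranges over the representatives of the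
  class \<open>T\<close>; they all give the same class, so it is the union of a single set.
\<close>

definition id_tensor ::
  "('l, 'm) ring_scheme \<Rightarrow> 'l set \<Rightarrow> ('l, 'a, 'n) module_scheme \<Rightarrow> ('a \<Rightarrow> 'a) \<Rightarrow>
     ('l \<times> 'a \<Rightarrow>\<^sub>0 int) set \<Rightarrow> ('l \<times> 'a \<Rightarrow>\<^sub>0 int) set" where
  "id_tensor L K A f T =
     (\<Union>u\<in>T. tensor_ideal L K A +>\<^bsub>pair_ring L A\<^esub> frag_extend (\<lambda>(l, a). frag_of (l, f a)) u)"

text \<open>
  \<open>id\<^sub>L \<otimes> \<sigma> : L \<otimes>\<^sub>K A \<rightarrow> L \<otimes>\<^sub>K A[x]\<close>, with the target identified with \<open>(L \<otimes>\<^sub>K A)[x]\<close> by sending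
  \<open>l \<otimes> (\<Sum>\<^sub>i a\<^sub>i x\<^sup>i)\<close> to \<open>\<Sum>\<^sub>i (l \<otimes> a\<^sub>i) x\<^sup>i\<close>. Thus the \<open>i\<close>-th coefficient is \<open>id\<^sub>L \<otimes> \<sigma>\<^sub>i\<close>, where \<open>\<sigma>\<^sub>i\<close>
  takes the \<open>i\<close>-th coefficient of \<open>\<sigma>\<close>. An element of \<^term>\<open>carrier (UP B)\<close> is its coefficient function.
\<close>

definition base_change_map ::
  "('l, 'm) ring_scheme \<Rightarrow> 'l set \<Rightarrow> ('l, 'a, 'n) module_scheme \<Rightarrow> ('a \<Rightarrow> nat \<Rightarrow> 'a) \<Rightarrow>
     ('l \<times> 'a \<Rightarrow>\<^sub>0 int) set \<Rightarrow> nat \<Rightarrow> ('l \<times> 'a \<Rightarrow>\<^sub>0 int) set" where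
  "base_change_map L K A \<sigma> T = (\<lambda>i. id_tensor L K A (\<lambda>a. coeff (UP A) (\<sigma> a) i) T)"

end

theory Submission
  imports Defs
begin

text \<open>
  Write \<open>B\<close> for \<open>L \<otimes>\<^sub>K A\<close>, \<open>\<tau>\<close> for the extended exponential map, \<open>d = deg\<^sub>\<tau> s\<close> and \<open>c = lc\<^sub>\<tau> s\<close>. As
  \<open>c\<close> is a nonzero divisor, minimality of \<open>d\<close> gives \<open>(x + y)\<^sup>d = x\<^sup>d + y\<^sup>d\<close> over \<open>B\<close>. Hence \<open>d\<close> divides
  every degree, and cancelling leading terms against powers of \<open>s\<close> puts \<open>c\<^sup>n b\<close> into \<open>B\<^sup>\<tau>[s]\<close> for each
  \<open>b\<close> and some \<open>n\<close>.

  A factor \<open>p = p\<^sub>i\<close> of \<open>c\<close> can be cancelled: if \<open>p b \<in> B\<^sup>\<tau>[s]\<close>, then, because \<open>B\<^sup>\<tau> = L + p B\<^sup>\<tau>\<close>, there are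
  \<open>f \<in> L[X]\<close> and \<open>w \<in> B\<^sup>\<tau>[s]\<close> with \<open>p b = f(s) + p w\<close>, so \<open>f(s) \<in> p B\<close>. If \<open>f \<noteq> 0\<close>, then \<open>f\<close> splits into linear
  factors and \<open>p B\<close> is prime, so \<open>s - \<mu> = p u\<close> for some \<open>\<mu> \<in> L\<close>; this \<open>u\<close> is a local slice with
  \<open>c = p lc\<^sub>\<tau> u\<close>, contradicting the minimality of \<open>s\<close>. Hence \<open>f = 0\<close> and \<open>b = w\<close>. Thus \<open>B = B\<^sup>\<tau>[s]\<close>.

  For the descent to \<open>A\<close>, a \<open>K\<close>-linear retraction \<open>L \<rightarrow> K\<close> induces an \<open>A\<close>-linear retraction \<open>B \<rightarrow> A\<close>
  commuting with the exponential maps; it maps \<open>B\<^sup>\<tau>[s]\<close> into \<open>A\<^sup>\<sigma>[s]\<close>.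
\<close>

section \<open>Exponential maps in terms of coefficients\<close>

lemma UP_coeff_apply: "f \<in> carrier (UP R) \<Longrightarrow> up_ring.coeff (UP R) f i = f i"
  by (simp add: UP_def)

text \<open>\<open>tau_tau\<close> is (E2) read coefficientwise: it compares the coefficients of x^j
  y^i on both sides. In this form the axiom gives degree bounds for the coefficients of
  \<open>\<tau> b\<close>, and it is additive in \<open>b\<close>.\<close>

locale exp_map = cring B for B (structure) +
  fixes \<tau>
  assumes tau_hom: "\<tau> \<in> ring_hom B (UP B)"
    and tau_0: "b \<in> carrier B \<Longrightarrow> \<tau> b 0 = b"
    and tau_tau: "b \<in> carrier B \<Longrightarrow> \<tau> (\<tau> b i) j = add_pow B ((i + j) choose i) (\<tau> b (i + j))"
begin

sublocale U: UP_cring B "UP B"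
  by unfold_locales

lemma tau_in_UP [simp]: "b \<in> carrier B \<Longrightarrow> \<tau> b \<in> carrier (UP B)"
  by (rule ring_hom_closed[OF tau_hom])

lemma coeff_tau: "b \<in> carrier B \<Longrightarrow> up_ring.coeff (UP B) (\<tau> b) i = \<tau> b i"
  by (simp add: UP_coeff_apply)

lemma tau_closed [simp]: "b \<in> carrier B \<Longrightarrow> \<tau> b i \<in> carrier B"
  using U.coeff_closed[OF tau_in_UP, of b i] by (simp add: coeff_tau)

lemma tau_add:
  assumes "a \<in> carrier B" "b \<in> carrier B"
  shows "\<tau> (a \<oplus> b) i = \<tau> a i \<oplus> \<tau> b i"
proof -
  have "\<tau> (a \<oplus> b) i = up_ring.coeff (UP B) (\<tau> a \<oplus>\<^bsub>UP B\<^esub> \<tau> b) i"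
    using assms coeff_tau[of "a \<oplus> b" i] ring_hom_add[OF tau_hom, of a b] by simp
  also have "\<dots> = \<tau> a i \<oplus> \<tau> b i"
    using assms by (simp add: coeff_tau)
  finally show ?thesis .
qed

lemma tau_zero [simp]: "\<tau> \<zero> i = \<zero>"
  using ring_hom_zero[OF tau_hom ring_axioms U.UP_ring] by (simp add: UP_def)

lemma tau_uminus: "a \<in> carrier B \<Longrightarrow> \<tau> (\<ominus> a) i = \<ominus> \<tau> a i"
  using tau_add[of "\<ominus> a" a i] minus_equality[of "\<tau> (\<ominus> a) i" "\<tau> a i"] by (simp add: l_neg)

lemma tau_minus: "a \<in> carrier B \<Longrightarrow> b \<in> carrier B \<Longrightarrow> \<tau> (a \<ominus> b) i = \<tau> a i \<ominus> \<tau> b i"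
  by (simp add: minus_eq tau_add tau_uminus)

lemma tau_mult:
  assumes "a \<in> carrier B" "b \<in> carrier B"
  shows "\<tau> (a \<otimes> b) n = (\<Oplus>i\<in>{..n}. \<tau> a i \<otimes> \<tau> b (n - i))"
proof -
  have "\<tau> (a \<otimes> b) n = up_ring.coeff (UP B) (\<tau> a \<otimes>\<^bsub>UP B\<^esub> \<tau> b) n"
    using assms coeff_tau[of "a \<otimes> b" n] ring_hom_mult[OF tau_hom, of a b] by simp
  also have "\<dots> = (\<Oplus>i\<in>{..n}. \<tau> a i \<otimes> \<tau> b (n - i))"
    using assms by (simp add: U.coeff_mult coeff_tau)
  finally show ?thesis .
qed

lemma tau_one: "\<tau> \<one> i = (if i = 0 then \<one> else \<zero>)"
  using ring_hom_one[OF tau_hom] by (simp add: UP_def)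

lemma invariant_iff: "b \<in> exp_invariants B \<tau> \<longleftrightarrow> b \<in> carrier B \<and> (\<forall>i>0. \<tau> b i = \<zero>)"
proof -
  have "\<tau> b = up_ring.monom (UP B) b 0 \<longleftrightarrow> (\<forall>i>0. \<tau> b i = \<zero>)" if b: "b \<in> carrier B"
  proof -
    have "up_ring.monom (UP B) b 0 = (\<lambda>i. if i = 0 then b else \<zero>)"
      using b by (simp add: UP_def)
    then show ?thesis
      using tau_0[OF b] by (auto simp: fun_eq_iff)
  qed
  then show ?thesis
    by (auto simp: exp_invariants_def)
qed

lemma invariantD: "b \<in> exp_invariants B \<tau> \<Longrightarrow> 0 < i \<Longrightarrow> \<tau> b i = \<zero>"
  by (simp add: invariant_iff)

text \<open>Only the term with index \<open>m\<close> can survive at \<open>m + n\<close>. Bounds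
  are used instead of degrees because the product of two top coefficients may vanish when
  \<open>B\<close> has zero divisors.\<close>

lemma tau_bound_mult:
  assumes "a \<in> carrier B" "b \<in> carrier B"
    and a: "\<And>i. i > m \<Longrightarrow> \<tau> a i = \<zero>" and b: "\<And>i. i > n \<Longrightarrow> \<tau> b i = \<zero>"
  shows "i > m + n \<Longrightarrow> \<tau> (a \<otimes> b) i = \<zero>"
    and "\<tau> (a \<otimes> b) (m + n) = \<tau> a m \<otimes> \<tau> b n"
proof -
  assume i: "i > m + n"
  have "\<tau> a j \<otimes> \<tau> b (i - j) = \<zero>" if "j \<le> i" for j
    using a[of j] b[of "i - j"] i assms(1,2) by (cases "j > m") auto
  then show "\<tau> (a \<otimes> b) i = \<zero>"
    using assms(1,2) by (simp add: tau_mult cong: finsum_cong)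
next
  have *: "\<tau> a j \<otimes> \<tau> b (m + n - j) = (if m = j then \<tau> a j \<otimes> \<tau> b (m + n - j) else \<zero>)"
    if "j \<le> m + n" for j
    using a[of j] b[of "m + n - j"] assms(1,2) that by (cases "j > m"; cases "j < m") auto
  have "\<tau> (a \<otimes> b) (m + n) = (\<Oplus>j\<in>{..m + n}. if m = j then \<tau> a j \<otimes> \<tau> b (m + n - j) else \<zero>)"
    unfolding tau_mult[OF assms(1,2)] using assms(1,2)
    by (intro finsum_cong') (auto simp: *[symmetric])
  also have "\<dots> = \<tau> a m \<otimes> \<tau> b n"
    using finsum_singleton[of m "{..m + n}" "\<lambda>j. \<tau> a j \<otimes> \<tau> b (m + n - j)"] assms(1,2) by simp
  finally show "\<tau> (a \<otimes> b) (m + n) = \<tau> a m \<otimes> \<tau> b n" .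
qed

lemma tau_bound_pow:
  assumes "s \<in> carrier B" "\<And>i. i > d \<Longrightarrow> \<tau> s i = \<zero>"
  shows "(\<forall>i > q * d. \<tau> (s [^] q) i = \<zero>) \<and> \<tau> (s [^] q) (q * d) = \<tau> s d [^] (q :: nat)"
proof (induction q)
  case 0
  then show ?case by (simp add: tau_one)
next
  case (Suc q)
  then show ?case
    using assms tau_bound_mult[of "s [^] q" s "q * d" d] by (simp add: add.commute)
qed

lemma tau_invariant_mult:
  assumes "a \<in> exp_invariants B \<tau>" "b \<in> carrier B"
  shows "\<tau> (a \<otimes> b) n = a \<otimes> \<tau> b n"
proof -
  have a: "a \<in> carrier B" "\<And>i. i > 0 \<Longrightarrow> \<tau> a i = \<zero>"
    using assms by (auto simp: invariant_iff)
  have "\<tau> (a \<otimes> b) n = (\<Oplus>i\<in>{..n}. if 0 = i then \<tau> a i \<otimes> \<tau> b (n - i) else \<zero>)"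
    unfolding tau_mult[OF a(1) assms(2)] using assms(2) a
    by (intro finsum_cong') auto
  also have "\<dots> = a \<otimes> \<tau> b n"
    using finsum_singleton[of 0 "{..n}" "\<lambda>i. \<tau> a i \<otimes> \<tau> b (n - i)"] assms(2) a by (simp add: tau_0)
  finally show ?thesis .
qed

lemma invariants_subring: "subring (exp_invariants B \<tau>) B"
proof (rule subringI)
  fix a assume a: "a \<in> exp_invariants B \<tau>"
  then have "\<tau> (\<zero> \<ominus> a) i = \<zero> \<ominus> \<tau> a i" for i
    by (simp add: tau_minus invariant_iff)
  then show "\<ominus> a \<in> exp_invariants B \<tau>"
    using a by (simp add: invariant_iff minus_eq)
qed (auto simp: invariant_iff tau_one tau_add tau_invariant_mult)

lemmas invariant_simps [simp, intro] =
  subringE(2,3,5,6,7)[OF invariants_subring]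

lemma invariant_closed [simp, intro]: "a \<in> exp_invariants B \<tau> \<Longrightarrow> a \<in> carrier B"
  by (simp add: exp_invariants_def)

lemma invariant_pow: "a \<in> exp_invariants B \<tau> \<Longrightarrow> a [^] (n :: nat) \<in> exp_invariants B \<tau>"
  by (induction n) auto

lemma invariant_ring_cring: "cring (invariant_ring B \<tau>)"
  using subcringI'[OF invariants_subring] subcring_iff[of "exp_invariants B \<tau>"] by auto

lemma tau_above_deg: "b \<in> carrier B \<Longrightarrow> exp_deg B \<tau> b < i \<Longrightarrow> \<tau> b i = \<zero>"
  using U.deg_aboveD[of "\<tau> b" i] by (simp add: exp_deg_def coeff_tau)

lemma exp_deg_le: "b \<in> carrier B \<Longrightarrow> (\<And>i. i > n \<Longrightarrow> \<tau> b i = \<zero>) \<Longrightarrow> exp_deg B \<tau> b \<le> n"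
  unfolding exp_deg_def by (rule U.deg_aboveI) (auto simp: coeff_tau)

lemma exp_lc_eq: "b \<in> carrier B \<Longrightarrow> exp_lc B \<tau> b = \<tau> b (exp_deg B \<tau> b)"
  by (simp add: exp_lc_def exp_deg_def coeff_tau)

lemma exp_lc_nonzero: "b \<in> carrier B \<Longrightarrow> exp_deg B \<tau> b \<noteq> 0 \<Longrightarrow> exp_lc B \<tau> b \<noteq> \<zero>"
  unfolding exp_deg_def exp_lc_def by (rule U.lcoeff_nonzero_deg) auto

lemma exp_deg_eqI:
  "b \<in> carrier B \<Longrightarrow> (\<And>i. i > n \<Longrightarrow> \<tau> b i = \<zero>) \<Longrightarrow> \<tau> b n \<noteq> \<zero> \<Longrightarrow> exp_deg B \<tau> b = n"
  using exp_deg_le[of b n] tau_above_deg[of b n] by fastforce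

lemma exp_deg_0_iff: "b \<in> carrier B \<Longrightarrow> exp_deg B \<tau> b = 0 \<longleftrightarrow> b \<in> exp_invariants B \<tau>"
  using exp_deg_le[of b 0] tau_above_deg[of b] by (auto simp del: invariant_closed simp: invariant_iff)

text \<open>For \<open>j > 0\<close> the coefficient of index \<open>j\<close> of
  \<open>\<tau>\<close> applied to the leading coefficient is a multiple of a coefficient of
  \<open>\<tau> b\<close> above its degree.\<close>

lemma exp_lc_invariant:
  assumes "b \<in> carrier B" shows "exp_lc B \<tau> b \<in> exp_invariants B \<tau>"
  using assms by (auto simp del: invariant_closed simp: invariant_iff exp_lc_eq tau_tau tau_above_deg)

end

section \<open>Passing from the identity in B[x,y] to coefficients\<close>

text \<open>Induction by Pascal's rule: multiplication by x acts on each coefficient, multiplication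
  by y shifts the outer index. For \<open>i > n\<close> the binomial coefficient is 0, so the
  truncated exponent \<open>n - i\<close> does no harm.\<close>

lemma (in cring) coeff_x_plus_y_pow:
  shows "up_ring.coeff (UP (UP R)) ((UP2_x R \<oplus>\<^bsub>UP (UP R)\<^esub> UP2_y R) [^]\<^bsub>UP (UP R)\<^esub> n) i =
    up_ring.monom (UP R) (add_pow R (n choose i) \<one>) (n - i)"
proof -
  interpret U: UP_cring R "UP R" by unfold_locales
  interpret V: UP_cring "UP R" "UP (UP R)" by unfold_locales
  have x: "UP2_x R \<in> carrier (UP (UP R))" and y: "UP2_y R \<in> carrier (UP (UP R))"
    by (simp_all add: UP2_x_def UP2_y_def)
  show ?thesis
  proof (induction n arbitrary: i)
    case 0
    then show ?case by (cases i) auto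
  next
    case (Suc n)
    define z where "z = (UP2_x R \<oplus>\<^bsub>UP (UP R)\<^esub> UP2_y R) [^]\<^bsub>UP (UP R)\<^esub> n"
    have z: "z \<in> carrier (UP (UP R))"
      using x y by (simp add: z_def)
    have zx: "up_ring.coeff (UP (UP R)) (UP2_x R \<otimes>\<^bsub>UP (UP R)\<^esub> z) i =
        up_ring.monom (UP R) \<one> 1 \<otimes>\<^bsub>UP R\<^esub> up_ring.coeff (UP (UP R)) z i" for i
      using V.coeff_monom_mult[OF _ z, of "up_ring.monom (UP R) \<one> 1" 0 i] by (simp add: UP2_x_def)
    have zy: "up_ring.coeff (UP (UP R)) (UP2_y R \<otimes>\<^bsub>UP (UP R)\<^esub> z) i =
        (case i of 0 \<Rightarrow> \<zero>\<^bsub>UP R\<^esub> | Suc j \<Rightarrow> up_ring.coeff (UP (UP R)) z j)" for i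
    proof (cases i)
      case 0
      then show ?thesis
        using z y by (simp add: V.coeff_mult) (simp add: UP2_y_def)
    next
      case (Suc j)
      then show ?thesis
        using V.coeff_monom_mult[OF _ z, of "\<one>\<^bsub>UP R\<^esub>" 1 j] z by (simp add: UP2_y_def)
    qed
    have IH: "up_ring.coeff (UP (UP R)) z j = up_ring.monom (UP R) (add_pow R (n choose j) \<one>) (n - j)" for j
      using Suc.IH by (simp add: z_def)
    have "(UP2_x R \<oplus>\<^bsub>UP (UP R)\<^esub> UP2_y R) [^]\<^bsub>UP (UP R)\<^esub> Suc n =
        UP2_x R \<otimes>\<^bsub>UP (UP R)\<^esub> z \<oplus>\<^bsub>UP (UP R)\<^esub> UP2_y R \<otimes>\<^bsub>UP (UP R)\<^esub> z"
      using x y z by (simp add: V.P.m_comm[of z] V.P.l_distr flip: z_def)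
    then have *: "up_ring.coeff (UP (UP R)) ((UP2_x R \<oplus>\<^bsub>UP (UP R)\<^esub> UP2_y R) [^]\<^bsub>UP (UP R)\<^esub> Suc n) i =
        up_ring.monom (UP R) \<one> 1 \<otimes>\<^bsub>UP R\<^esub> up_ring.coeff (UP (UP R)) z i \<oplus>\<^bsub>UP R\<^esub>
        (case i of 0 \<Rightarrow> \<zero>\<^bsub>UP R\<^esub> | Suc j \<Rightarrow> up_ring.coeff (UP (UP R)) z j)"
      using x y z by (simp only: V.coeff_add V.P.m_closed zx zy)
    have shift: "up_ring.monom (UP R) \<one> 1 \<otimes>\<^bsub>UP R\<^esub> up_ring.monom (UP R) a m = up_ring.monom (UP R) a (Suc m)"
      if "a \<in> carrier R" for a m
      using U.monom_mult[of \<one> a 1 m] that by simp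
    show ?case
    proof (cases i)
      case 0
      then show ?thesis
        unfolding * IH by (simp add: shift[simplified])
    next
      case (Suc j)
      show ?thesis
      \<comment> \<open>For \<open>Suc j \<le> n\<close> both summands are multiples of x^(n - j)
        and Pascal's rule adds them. Otherwise the subtraction \<open>n - Suc j\<close> is
        truncated, but the first binomial coefficient vanishes.\<close>
      proof (cases "Suc j \<le> n")
        case True
        then have "Suc (n - Suc j) = n - j" by simp
        then show ?thesis
          using U.monom_add[of "add_pow R (n choose Suc j) \<one>" "add_pow R (n choose j) \<one>" "n - j"]
          unfolding * unfolding IH Suc by (simp add: shift[simplified] add.nat_pow_mult add.commute)
      next
        case False
        then show ?thesis
          unfolding * unfolding IH Suc by (simp add: shift[simplified] binomial_eq_0)
      qed
    qed
  qed
qed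

text \<open>Take the coefficient of y^i and then that of x^j. On the left the only contribution is
  that of \<open>\<tau> (\<tau> b i)\<close>, on the right that of the summand
  \<open>n = i + j\<close>.\<close>

lemma exponential_map_imp_exp_map:
  assumes "cring B" and ex: "exponential_map B \<tau>"
  shows "exp_map B \<tau>"
proof -
  interpret cring B by fact
  interpret U: UP_cring B "UP B" by unfold_locales
  interpret V: UP_cring "UP B" "UP (UP B)" by unfold_locales
  have hom: "\<tau> \<in> ring_hom B (UP B)"
    using ex by (simp add: exponential_map_def)
  have UP: "\<tau> b \<in> carrier (UP B)" if "b \<in> carrier B" for b
    using ring_hom_closed[OF hom that] .
  have app: "up_ring.coeff (UP B) (\<tau> b) i = \<tau> b i" if "b \<in> carrier B" for b i
    by (rule UP_coeff_apply[OF UP[OF that]])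
  have closed: "\<tau> b i \<in> carrier B" if "b \<in> carrier B" for b i
    using U.coeff_closed[OF UP[OF that], of i] app[OF that] by simp
  show ?thesis
  proof
    show "\<tau> \<in> ring_hom B (UP B)" by (rule hom)
    show "\<tau> b 0 = b" if "b \<in> carrier B" for b
      using ex that app[OF that, of 0] by (simp add: exponential_map_def)
    fix b i j
    assume b: "b \<in> carrier B"
    define m where "m = deg B (\<tau> b)"
    have above: "\<tau> b n = \<zero>\<^bsub>B\<^esub>" if "n > m" for n
      using U.deg_aboveD[OF _ UP[OF b], of n] that app[OF b] by (simp add: m_def)
    have xy: "UP2_x B \<in> carrier (UP (UP B))" "UP2_y B \<in> carrier (UP (UP B))"
      by (simp_all add: UP2_x_def UP2_y_def)
    have ypow: "UP2_y B [^]\<^bsub>UP (UP B)\<^esub> n = up_ring.monom (UP (UP B)) \<one>\<^bsub>UP B\<^esub> n" for n :: nat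
      using V.monom_pow[of "\<one>\<^bsub>UP B\<^esub>" 1 n] by (simp add: UP2_y_def)
    let ?l = "\<lambda>n. up_ring.monom (UP (UP B)) (\<tau> (\<tau> b n)) 0 \<otimes>\<^bsub>UP (UP B)\<^esub> UP2_y B [^]\<^bsub>UP (UP B)\<^esub> n"
    let ?r = "\<lambda>n. UP2_const B (\<tau> b n) \<otimes>\<^bsub>UP (UP B)\<^esub>
      (UP2_x B \<oplus>\<^bsub>UP (UP B)\<^esub> UP2_y B) [^]\<^bsub>UP (UP B)\<^esub> n"
    have eq: "(\<Oplus>\<^bsub>UP (UP B)\<^esub>n\<in>{..m}. ?l n) = (\<Oplus>\<^bsub>UP (UP B)\<^esub>n\<in>{..m}. ?r n)"
      using ex b unfolding exponential_map_def by (simp add: app m_def)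
    have l: "?l n = up_ring.monom (UP (UP B)) (\<tau> (\<tau> b n)) n" for n
      using V.monom_mult[of "\<tau> (\<tau> b n)" "\<one>\<^bsub>UP B\<^esub>" 0 n] UP closed b by (simp add: ypow)
    have "up_ring.coeff (UP (UP B)) (\<Oplus>\<^bsub>UP (UP B)\<^esub>n\<in>{..m}. ?l n) i =
        (\<Oplus>\<^bsub>UP B\<^esub>n\<in>{..m}. if i = n then \<tau> (\<tau> b n) else \<zero>\<^bsub>UP B\<^esub>)"
      unfolding l using UP closed b by (subst V.coeff_finsum) (auto intro!: U.P.finsum_cong')
    \<comment> \<open>The sum stops at \<open>m\<close> while \<open>i\<close> is arbitrary; beyond
      \<open>m\<close> both sides vanish.\<close>
    also have "\<dots> = \<tau> (\<tau> b i)"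
    proof (cases "i \<le> m")
      case True
      then show ?thesis
        using U.P.finsum_singleton[of i "{..m}" "\<lambda>n. \<tau> (\<tau> b n)"] UP closed b by auto
    next
      case False
      then have "\<tau> (\<tau> b i) = \<zero>\<^bsub>UP B\<^esub>"
        using above ring_hom_zero[OF hom ring_axioms U.UP_ring] by simp
      moreover have "(\<Oplus>\<^bsub>UP B\<^esub>n\<in>{..m}. if i = n then \<tau> (\<tau> b n) else \<zero>\<^bsub>UP B\<^esub>) =
          (\<Oplus>\<^bsub>UP B\<^esub>n\<in>{..m}. \<zero>\<^bsub>UP B\<^esub>)"
        using False by (intro U.P.finsum_cong') auto
      ultimately show ?thesis by simp
    qed
    finally have lhs: "up_ring.coeff (UP (UP B)) (\<Oplus>\<^bsub>UP (UP B)\<^esub>n\<in>{..m}. ?l n) i = \<tau> (\<tau> b i)" .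
    have r_closed: "?r n \<in> carrier (UP (UP B))" for n
      using xy closed b by (simp add: UP2_const_def)
    have r: "up_ring.coeff (UP (UP B)) (?r n) i =
        up_ring.monom (UP B) (add_pow B (n choose i) (\<tau> b n)) (n - i)" for n
    proof -
      let ?z = "(UP2_x B \<oplus>\<^bsub>UP (UP B)\<^esub> UP2_y B) [^]\<^bsub>UP (UP B)\<^esub> n"
      have "up_ring.coeff (UP (UP B)) (?r n) i =
          up_ring.monom (UP B) (\<tau> b n) 0 \<otimes>\<^bsub>UP B\<^esub> up_ring.coeff (UP (UP B)) ?z i"
        using V.coeff_monom_mult[of "up_ring.monom (UP B) (\<tau> b n) 0" ?z 0 i] xy closed b
        by (simp add: UP2_const_def)
      also have "\<dots> = up_ring.monom (UP B) (add_pow B (n choose i) (\<tau> b n)) (n - i)"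
        using closed[OF b, of n] U.monom_mult[of "\<tau> b n" "add_pow B (n choose i) \<one>\<^bsub>B\<^esub>" 0 "n - i"]
        by (simp add: coeff_x_plus_y_pow add_pow_rdistr)
      finally show ?thesis .
    qed
    have "up_ring.coeff (UP B) (up_ring.coeff (UP (UP B)) (\<Oplus>\<^bsub>UP (UP B)\<^esub>n\<in>{..m}. ?r n) i) j =
        (\<Oplus>\<^bsub>B\<^esub>n\<in>{..m}. up_ring.coeff (UP B) (up_ring.monom (UP B) (add_pow B (n choose i) (\<tau> b n)) (n - i)) j)"
      using r_closed closed b by (simp add: V.coeff_finsum r U.coeff_finsum Pi_def del: U.coeff_monom)
    \<comment> \<open>For \<open>n < i\<close> the truncated exponent \<open>n - i\<close> is 0 and
      could match \<open>j = 0\<close>, but then \<open>n choose i = 0\<close>.\<close>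
    also have "\<dots> = (\<Oplus>\<^bsub>B\<^esub>n\<in>{..m}. if i + j = n then add_pow B (n choose i) (\<tau> b n) else \<zero>\<^bsub>B\<^esub>)"
      using closed b by (intro finsum_cong') (auto simp: binomial_eq_0)
    also have "\<dots> = add_pow B ((i + j) choose i) (\<tau> b (i + j))"
    proof (cases "i + j \<le> m")
      case True
      then show ?thesis
        using finsum_singleton[of "i + j" "{..m}" "\<lambda>n. add_pow B (n choose i) (\<tau> b n)"] closed b
        by auto
    next
      case False
      then have "(\<Oplus>\<^bsub>B\<^esub>n\<in>{..m}. if i + j = n then add_pow B (n choose i) (\<tau> b n) else \<zero>\<^bsub>B\<^esub>) =
          (\<Oplus>\<^bsub>B\<^esub>n\<in>{..m}. \<zero>\<^bsub>B\<^esub>)"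
        by (intro finsum_cong') auto
      then show ?thesis
        using above False by simp
    qed
    finally show "\<tau> (\<tau> b i) j = add_pow B ((i + j) choose i) (\<tau> b (i + j))"
      using lhs eq app[OF closed[OF b, of i], of j] by simp
  qed
qed

section \<open>Local slices\<close>

text \<open>Modulo the numbers \<open>d choose i\<close> with \<open>0 < i < d\<close> one has \<open>(x + y)\<^sup>d = x\<^sup>d + y\<^sup>d\<close>; compare
  coefficients in \<open>(x + y)\<^bsup>qd + r\<^esup> = (x\<^sup>d + y\<^sup>d)\<^sup>q (x + y)\<^sup>r\<close>.\<close>

lemma binomial_cong_one:
  assumes "d > 0" "r < d"
  shows "\<exists>w. (q * d + r) choose (q * d) = 1 + (\<Sum>i\<in>{0<..<d}. (d choose i) * w i)"
proof (induction q)
  case 0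
  show ?case by (intro exI[of _ "\<lambda>_. 0"]) simp
next
  case (Suc q)
  then obtain w where w: "(q * d + r) choose (q * d) = 1 + (\<Sum>i\<in>{0<..<d}. (d choose i) * w i)"
    by blast
  let ?n = "q * d + r" and ?k = "Suc q * d"
  \<comment> \<open>In Vandermonde's sum for \<open>d + ?n\<close>, the term \<open>i = 0\<close>
    vanishes because \<open>r < d\<close>, the term \<open>i = d\<close> is the previous binomial
    coefficient, the terms with \<open>0 < i < d\<close> are absorbed into the new \<open>w\<close>,
    and those with \<open>i > d\<close> vanish.\<close>
  have split: "{..?k} = {0, d} \<union> {0<..<d} \<union> {d<..?k}"
    using assms by auto
  have "(Suc q * d + r) choose ?k = (d + ?n) choose ?k"
    by (simp add: algebra_simps)
  also have "\<dots> = (\<Sum>i\<le>?k. (d choose i) * (?n choose (?k - i)))"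
    by (rule vandermonde[symmetric])
  also have "\<dots> = (\<Sum>i\<in>{0, d} \<union> {0<..<d}. (d choose i) * (?n choose (?k - i)))"
    unfolding split by (subst sum.union_disjoint) (auto simp: binomial_eq_0)
  also have "\<dots> = (?n choose ?k) + (?n choose (q * d))
      + (\<Sum>i\<in>{0<..<d}. (d choose i) * (?n choose (?k - i)))"
    using assms by (subst sum.union_disjoint) auto
  also have "?n choose ?k = 0"
    using assms by (simp add: binomial_eq_0)
  also have "0 + (?n choose (q * d)) + (\<Sum>i\<in>{0<..<d}. (d choose i) * (?n choose (?k - i)))
      = 1 + (\<Sum>i\<in>{0<..<d}. (d choose i) * (w i + (?n choose (?k - i))))"
    unfolding w by (simp add: sum.distrib distrib_left)
  finally show ?case
    by (intro exI[of _ "\<lambda>i. w i + (?n choose (?k - i))"])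
qed

text \<open>An element killed by some integers is killed by their combinations; this lets
  \<open>binomial_cong_one\<close> act on ring elements.\<close>

lemma (in ring) add_pow_sum_eq_zero:
  assumes "a \<in> carrier R" "\<And>i. i \<in> I \<Longrightarrow> add_pow R (f i :: nat) a = \<zero>"
  shows "add_pow R (\<Sum>i\<in>I. f i * g i :: nat) a = \<zero>"
  using assms
proof (induction I rule: infinite_finite_induct)
  case (insert i I)
  have "add_pow R (f i * g i) a = add_pow R (g i) (add_pow R (f i) a)"
    using insert.prems(1) add.nat_pow_pow[of a "g i" "f i"] by (simp add: mult.commute)
  then show ?case
    using insert by (simp flip: add.nat_pow_mult)
qed auto

text \<open>Instantiated for the base change and for \<open>A\<close>, with the same
  \<open>d\<close>. The condition on principal ideals in the minimality of the slice concerns the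
  base change only and enters through \<open>root_not_in_factor\<close>.\<close>

locale exp_slice = exp_map +
  fixes s d
  assumes s_closed [simp]: "s \<in> carrier B"
    and d_pos: "d > 0"
    and above_d: "\<And>i. i > d \<Longrightarrow> \<tau> s i = \<zero>"
    and d_minimal: "\<And>b. b \<in> carrier B \<Longrightarrow> b \<notin> exp_invariants B \<tau> \<Longrightarrow> d \<le> exp_deg B \<tau> b"
    and lc_nonzero_divisor: "nonzero_divisor B (\<tau> s d)"
begin

abbreviation "c \<equiv> \<tau> s d"

lemma c_cancel: "b \<in> carrier B \<Longrightarrow> c \<otimes> b = \<zero> \<Longrightarrow> b = \<zero>"
  using lc_nonzero_divisor by (simp add: nonzero_divisor_def)

lemma c_pow_cancel: "b \<in> carrier B \<Longrightarrow> c [^] (n::nat) \<otimes> b = \<zero> \<Longrightarrow> b = \<zero>"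
proof (induction n)
  case (Suc n)
  have "c \<otimes> (c [^] n \<otimes> b) = \<zero>"
    using Suc.prems m_assoc[of "c [^] n" c b] m_lcomm[of c "c [^] n" b] by simp
  then have "c [^] n \<otimes> b = \<zero>"
    using Suc.prems c_cancel[of "c [^] n \<otimes> b"] by simp
  then show ?case
    by (rule Suc.IH[OF Suc.prems(1)])
qed simp

lemma c_invariant: "c \<in> exp_invariants B \<tau>"
  by (simp del: invariant_closed add: invariant_iff tau_tau above_d)

text \<open>The coefficient \<open>\<tau> b i\<close> has degree at most \<open>m - i < d\<close>,
  so it is invariant by minimality of \<open>d\<close>. The multiple of \<open>\<tau> b m\<close> in
  question is its coefficient of positive index \<open>m - i\<close>.\<close>

lemma tau_zero_below_d:
  assumes "b \<in> carrier B" "m > 0" "\<And>i. i > m \<Longrightarrow> \<tau> b i = \<zero>" "m < i + d" "i < m"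
  shows "add_pow B (m choose i) (\<tau> b m) = \<zero>"
proof -
  have "exp_deg B \<tau> (\<tau> b i) \<le> m - i"
    using assms by (intro exp_deg_le) (auto simp: tau_tau)
  also have "m - i < d"
    using assms by linarith
  finally have "\<tau> b i \<in> exp_invariants B \<tau>"
    using d_minimal[of "\<tau> b i"] assms(1) by (meson linorder_not_le tau_closed)
  then have "\<tau> (\<tau> b i) (m - i) = \<zero>"
    using assms by (simp del: invariant_closed add: invariant_iff)
  then show ?thesis
    using assms by (simp add: tau_tau)
qed

text \<open>By \<open>tau_zero_below_d\<close> for \<open>s\<close>, the integers
  \<open>d choose i\<close> with \<open>0 < i < d\<close> kill \<open>c\<close>, hence every
  element, since \<open>c\<close> is a nonzero divisor. If \<open>m = q * d + r\<close> with
  \<open>0 < r < d\<close>, then \<open>m choose (q * d)\<close> therefore acts as 1; but it kills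
  \<open>\<tau> b m\<close>, again by \<open>tau_zero_below_d\<close>.\<close>

lemma d_dvd_deg:
  assumes b: "b \<in> carrier B" and bnd: "\<And>i. i > m \<Longrightarrow> \<tau> b i = \<zero>" and nz: "\<tau> b m \<noteq> \<zero>"
  shows "d dvd m"
proof (rule ccontr)
  assume nd: "\<not> d dvd m"
  define q r where "q = m div d" and "r = m mod d"
  have m: "m = q * d + r" and r: "0 < r" "r < d"
    using nd d_pos by (auto simp: q_def r_def dvd_eq_mod_eq_0)
  obtain w where w: "m choose (q * d) = 1 + (\<Sum>i\<in>{0<..<d}. (d choose i) * w i)"
    using binomial_cong_one[OF d_pos r(2), of q] m by auto
  have "add_pow B (d choose i) (\<tau> b m) = \<zero>" if "i \<in> {0<..<d}" for i
  proof -
    have "add_pow B (d choose i) (c) = \<zero>"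
      using tau_zero_below_d[of s d i] that above_d by auto
    then have "c \<otimes> (add_pow B (d choose i) (\<tau> b m)) = \<zero>"
      using b by (metis add_pow_ldistr add_pow_rdistr l_null s_closed tau_closed)
    then show ?thesis
      using c_cancel b by simp
  qed
  then have "add_pow B (m choose (q * d)) (\<tau> b m) = \<tau> b m"
    using b add_pow_sum_eq_zero[of "\<tau> b m" "{0<..<d}" "\<lambda>i. d choose i" w]
    unfolding w by (simp flip: add.nat_pow_mult)
  moreover have "add_pow B (m choose (q * d)) (\<tau> b m) = \<zero>"
    using r b bnd by (intro tau_zero_below_d) (auto simp: m)
  ultimately show False
    using nz by simp
qed

section \<open>The subring of polynomials in s with invariant coefficients\<close>

abbreviation "Inv_s \<equiv> simple_extension (exp_invariants B \<tau>) s"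

lemma Inv_s_closed: "a \<in> Inv_s \<Longrightarrow> a \<in> carrier B"
  using simple_extension_in_carrier[OF subringE(1)[OF invariants_subring] s_closed] by auto

lemma Inv_s_invariant: "a \<in> exp_invariants B \<tau> \<Longrightarrow> a \<in> Inv_s"
  using simple_extension_incl[OF subringE(1)[OF invariants_subring] s_closed] by auto

lemma Inv_s_add: "a \<in> Inv_s \<Longrightarrow> b \<in> Inv_s \<Longrightarrow> a \<oplus> b \<in> Inv_s"
proof (induction a arbitrary: b rule: simple_extension.induct)
  case zero
  then show ?case by (simp add: Inv_s_closed)
next
  case (lin a k)
  from lin.prems show ?case
  proof cases
    case zero
    then show ?thesis using lin simple_extension.lin by (simp add: Inv_s_closed)
  next
    case (lin a' k')
    have "(a \<oplus> a') \<otimes> s \<oplus> (k \<oplus> k') \<in> Inv_s"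
      using lin \<open>k \<in> _\<close> lin.IH by (intro simple_extension.lin) auto
    also have "(a \<oplus> a') \<otimes> s \<oplus> (k \<oplus> k') = a \<otimes> s \<oplus> k \<oplus> (a' \<otimes> s \<oplus> k')"
      using lin \<open>k \<in> _\<close> \<open>a \<in> _\<close> Inv_s_closed by (simp add: l_distr a_ac)
    finally show ?thesis using lin by simp
  qed
qed

lemma Inv_s_scale: "a \<in> Inv_s \<Longrightarrow> k \<in> exp_invariants B \<tau> \<Longrightarrow> k \<otimes> a \<in> Inv_s"
proof (induction a rule: simple_extension.induct)
  case (lin a k')
  have "(k \<otimes> a) \<otimes> s \<oplus> k \<otimes> k' \<in> Inv_s"
    using lin by (intro simple_extension.lin) auto
  then show ?case
    using lin Inv_s_closed by (simp add: r_distr m_assoc)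
qed auto

lemma Inv_s_pow: "s [^] (n::nat) \<in> Inv_s"
proof (induction n)
  case 0
  then show ?case by (simp add: Inv_s_invariant)
next
  case (Suc n)
  then show ?case
    using simple_extension.lin[OF Suc invariant_simps(1)] by simp
qed

text \<open>Pseudo-division by powers of \<open>s\<close>, by induction on the degree; as
  \<open>c\<close> need not be invertible, every step costs a power of \<open>c\<close>.\<close>

lemma c_pow_mult_mem:
  assumes "b \<in> carrier B" shows "\<exists>n::nat. c [^] n \<otimes> b \<in> Inv_s"
  using assms
proof (induction "exp_deg B \<tau> b" arbitrary: b rule: less_induct)
  case less
  define m where "m = exp_deg B \<tau> b"
  show ?case
  proof (cases "m = 0")
    case True
    then have "c [^] (0::nat) \<otimes> b \<in> Inv_s"
      using less.prems exp_deg_0_iff Inv_s_invariant by (simp add: m_def)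
    then show ?thesis by blast
  next
    case False
    have bm: "\<tau> b m \<in> exp_invariants B \<tau>" "\<tau> b m \<noteq> \<zero>"
      using exp_lc_invariant[of b] exp_lc_nonzero[of b] False less.prems
      by (auto simp: exp_lc_eq m_def)
    have above_m: "\<tau> b i = \<zero>" if "i > m" for i
      using that less.prems tau_above_deg m_def by blast
    obtain q where q: "m = q * d"
      using d_dvd_deg[OF less.prems above_m bm(2)] by (metis dvdE mult.commute)
    note pow = tau_bound_pow[of s d q, OF s_closed above_d, folded q]
    note inv = bm(1) invariant_pow[OF c_invariant, of q]
    \<comment> \<open>Both terms have the coefficient \<open>c [^] q \<otimes> \<tau> b m\<close> at
      \<open>m = q * d\<close> and none above it, so the difference has smaller degree.\<close>
    define b' where "b' = c [^] q \<otimes> b \<ominus> \<tau> b m \<otimes> s [^] q"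
    have b': "b' \<in> carrier B"
      using less.prems by (simp add: b'_def)
    have tau_b': "\<tau> b' i = c [^] q \<otimes> \<tau> b i \<ominus> \<tau> b m \<otimes> \<tau> (s [^] q) i" for i
      using less.prems inv by (simp add: b'_def tau_minus tau_invariant_mult)
    have "\<tau> b' i = \<zero>" if "i \<ge> m" for i
      using that pow less.prems above_m
      by (cases "i = m") (auto simp: tau_b' m_comm minus_eq r_neg)
    then have "exp_deg B \<tau> b' \<le> m - 1"
      using b' False by (intro exp_deg_le) auto
    then have "exp_deg B \<tau> b' < exp_deg B \<tau> b"
      using False by (simp add: m_def)
    then obtain n where n: "c [^] (n::nat) \<otimes> b' \<in> Inv_s"
      using less.hyps b' by blast
    have "c [^] n \<otimes> b' \<oplus> (c [^] n \<otimes> \<tau> b m) \<otimes> s [^] q \<in> Inv_s"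
      using inv invariant_pow[OF c_invariant, of n]
      by (intro Inv_s_add[OF n] Inv_s_scale[OF Inv_s_pow]) auto
    also have "c [^] n \<otimes> b' \<oplus> (c [^] n \<otimes> \<tau> b m) \<otimes> s [^] q = c [^] n \<otimes> (c [^] q \<otimes> b)"
    proof -
      have "c [^] n \<in> carrier B" "c [^] q \<in> carrier B" "\<tau> b m \<in> carrier B" "s [^] q \<in> carrier B"
        using less.prems by auto
      then show ?thesis
        unfolding b'_def using less.prems by algebra
    qed
    also have "\<dots> = c [^] (n + q) \<otimes> b"
      using less.prems by (simp add: nat_pow_mult flip: m_assoc)
    finally show ?thesis by blast
  qed
qed

end

section \<open>Cancelling a factor of the leading coefficient\<close>

text \<open>Links two models of polynomials: coefficient functions, as in \<open>UP\<close>, and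
  coefficient lists that start with the leading coefficient, whence \<open>rev\<close>.\<close>

lemma (in ring) eval_map_rev_upt:
  assumes "\<And>i. f i \<in> carrier R" "x \<in> carrier R"
  shows "eval (map f (rev [0..<n])) x = (\<Oplus>i\<in>{..<n}. f i \<otimes> x [^] i)"
proof (induction n)
  case (Suc n)
  then show ?case
    using assms by (simp add: lessThan_Suc Pi_def)
qed simp

text \<open>Splitting is known for coefficient lists, whereas the remainder theorem and evaluation
  along a homomorphism are used for \<open>UP\<close>. The list \<open>P\<close> carries the root
  over.\<close>

lemma (in algebraically_closed) UP_root_exists:
  assumes f: "f \<in> carrier (UP L)" and deg: "deg L f > 0"
  shows "\<exists>\<mu>\<in>carrier L. UnivPoly.eval L L id \<mu> f = \<zero>"
proof -
  interpret U: UP_cring L "UP L" by unfold_locales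
  define n where "n = deg L f"
  define P where "P = map f (rev [0..<Suc n])"
  have fc: "f i \<in> carrier L" for i
    using U.coeff_closed[OF f, of i] by (simp add: UP_coeff_apply[OF f])
  have "f n \<noteq> \<zero>"
    using U.lcoeff_nonzero_deg[of f] f deg by (simp add: n_def UP_coeff_apply)
  then have P: "P \<in> carrier (poly_ring L)" and "degree P = n"
    using fc by (auto simp: P_def univ_poly_def polynomial_def)
  then have "size (roots P) > 0"
    using roots_over_carrier[OF P] deg by (simp add: splitted_def n_def)
  then obtain \<mu> where "\<mu> \<in># roots P"
    by (metis multiset_nonemptyE nonempty_has_size)
  then have \<mu>: "\<mu> \<in> carrier L" "eval P \<mu> = \<zero>"
    using roots_mem_iff_is_root[OF P] by (auto simp: is_root_def)
  have "UnivPoly.eval L L id \<mu> f = (\<Oplus>i\<in>{..n}. f i \<otimes> \<mu> [^] i)"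
    using U.eval_on_carrier[OF f, of L id \<mu>] by (simp add: n_def UP_coeff_apply[OF f])
  also have "\<dots> = eval P \<mu>"
    using eval_map_rev_upt[of f \<mu> "Suc n"] fc \<mu>(1) by (simp only: P_def lessThan_Suc_atMost)
  finally show ?thesis
    using \<mu> by auto
qed

text \<open>Induction on the degree: a root \<mu> splits off the factor X - \<mu>, and primality
  puts into \<open>P\<close> the value at \<open>s\<close> of this factor or of the cofactor. A
  nonzero constant is a unit, and its image cannot lie in the proper ideal \<open>P\<close>.\<close>

lemma (in algebraically_closed) root_in_prime:
  assumes B: "cring B" and \<eta>: "\<eta> \<in> ring_hom L B" and P: "primeideal P B"
    and s: "s \<in> carrier B" and f: "f \<in> carrier (UP L)" "f \<noteq> \<zero>\<^bsub>UP L\<^esub>"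
    and eval: "UnivPoly.eval L B \<eta> s f \<in> P"
  shows "\<exists>\<mu>\<in>carrier L. s \<ominus>\<^bsub>B\<^esub> \<eta> \<mu> \<in> P"
  using f eval
proof (induction "deg L f" arbitrary: f rule: less_induct)
  case less
  interpret B: cring B by fact
  interpret P: primeideal P B by fact
  interpret U: UP_domain L "UP L" by unfold_locales
  interpret E: UP_pre_univ_prop L B \<eta> "UP L"
    using UP_pre_univ_propI[OF is_cring B \<eta>] .
  interpret ev: ring_hom_cring "UP L" B "UnivPoly.eval L B \<eta> s"
    by (intro ring_hom_cringI U.UP_cring B E.eval_ring_hom s)
  show ?case
  proof (cases "deg L f = 0")
    case True
    define a where "a = up_ring.coeff (UP L) f 0"
    have a: "a \<in> carrier L" "f = up_ring.monom (UP L) a 0"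
      using U.deg_zero_impl_monom[OF less.prems(1) True] less.prems by (auto simp: a_def)
    then have "a \<noteq> \<zero>"
      using less.prems(2) by auto
    then have inv: "inv a \<in> carrier L" "inv a \<otimes> a = \<one>"
      using a field_Units by auto
    have "\<eta> a \<in> P"
      using less.prems(3) E.eval_const[OF s a(1)] a by simp
    then have "\<eta> (inv a) \<otimes>\<^bsub>B\<^esub> \<eta> a \<in> P"
      using inv ring_hom_closed[OF \<eta>] by (intro P.I_l_closed) auto
    then have "\<one>\<^bsub>B\<^esub> \<in> P"
      using inv a ring_hom_mult[OF \<eta>, of "inv a" a] ring_hom_one[OF \<eta>] by simp
    then show ?thesis
      using P.one_imp_carrier P.I_notcarr by auto
  next
    case False
    then obtain \<mu> where \<mu>: "\<mu> \<in> carrier L" "UnivPoly.eval L L id \<mu> f = \<zero>"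
      using UP_root_exists[OF less.prems(1)] by auto
    define q1 where "q1 = up_ring.monom (UP L) \<one> 1 \<ominus>\<^bsub>UP L\<^esub> up_ring.monom (UP L) \<mu> 0"
    have q1: "q1 \<in> carrier (UP L)"
      using \<mu> by (simp add: q1_def U.P.minus_closed)
    have "carrier L \<noteq> {\<zero>}"
      using one_closed one_not_zero by blast
    then obtain q where q: "q \<in> carrier (UP L)" "f = q1 \<otimes>\<^bsub>UP L\<^esub> q"
      using U.remainder_theorem[OF less.prems(1) \<mu>(1)] \<mu>(2) q1 by (fastforce simp: q1_def)
    have ev_q1: "UnivPoly.eval L B \<eta> s q1 = s \<ominus>\<^bsub>B\<^esub> \<eta> \<mu>"
      using \<mu>(1) E.eval_monom1[OF s] E.eval_const[OF s \<mu>(1)]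
      by (simp add: q1_def U.P.minus_eq B.minus_eq)
    have nz: "q1 \<noteq> \<zero>\<^bsub>UP L\<^esub>" "q \<noteq> \<zero>\<^bsub>UP L\<^esub>"
      using less.prems(2) q q1 by auto
    have "deg L q1 = 1"
      unfolding q1_def using U.deg_minus_monom[OF \<mu>(1)] \<open>carrier L \<noteq> {\<zero>}\<close> by simp
    then have "deg L q < deg L f"
      using U.deg_mult[OF nz q1 q(1)] q by simp
    have "(s \<ominus>\<^bsub>B\<^esub> \<eta> \<mu>) \<otimes>\<^bsub>B\<^esub> UnivPoly.eval L B \<eta> s q \<in> P"
      using less.prems(3) q q1 ev_q1 by simp
    then have "s \<ominus>\<^bsub>B\<^esub> \<eta> \<mu> \<in> P \<or> UnivPoly.eval L B \<eta> s q \<in> P"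
      using s \<mu> q by (intro P.I_prime) auto
    then show ?thesis
      using less.hyps[OF \<open>deg L q < deg L f\<close> q(1) nz(2)] \<mu>(1) by blast
  qed
qed

section \<open>Transcendence of s, and cancellation of one factor\<close>

context exp_slice
begin

text \<open>The degree in \<open>s\<close> can be read off from \<open>\<tau>\<close>. The first
  bound also covers the empty list, and applied to the tail of \<open>p\<close> it removes the tail
  from the coefficient at \<open>d * (length p - 1)\<close>, so that only the leading term
  remains.\<close>

lemma tau_eval:
  assumes "set p \<subseteq> exp_invariants B \<tau>"
  shows "j \<ge> d * length p \<Longrightarrow> \<tau> (eval p s) j = \<zero>"
    and "p \<noteq> [] \<Longrightarrow> \<tau> (eval p s) (d * (length p - 1)) = hd p \<otimes> c [^] (length p - 1)"
proof -
  have *: "eval p s \<in> carrier B" if "set p \<subseteq> exp_invariants B \<tau>" for p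
    using that by (intro eval_in_carrier) auto
  note pow = tau_bound_pow[of s d, OF s_closed above_d]
  have main: "\<tau> (eval p s) j = \<zero>" if "set p \<subseteq> exp_invariants B \<tau>" "j \<ge> d * length p" for p j
    using that
  proof (induction p)
    case (Cons a p)
    moreover have "j > length p * d"
      using Cons.prems d_pos by (simp add: mult.commute)
    ultimately show ?case
      using *[of p] pow[of "length p"] by (simp add: tau_add tau_invariant_mult mult.commute)
  qed simp
  then show "j \<ge> d * length p \<Longrightarrow> \<tau> (eval p s) j = \<zero>"
    using assms by blast
  show "\<tau> (eval p s) (d * (length p - 1)) = hd p \<otimes> c [^] (length p - 1)" if "p \<noteq> []"
  proof (cases p)
    case (Cons a q)
    then show ?thesis
      using *[of q] assms pow[of "length q"] main[of q "d * length q"]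
      by (simp add: tau_add tau_invariant_mult mult.commute)
  qed (use that in simp)
qed

text \<open>The heads agree after multiplication by a power of \<open>c\<close>, which cancels; then
  the tails are compared.\<close>

lemma eval_eq_imp_eq:
  assumes "set p \<subseteq> exp_invariants B \<tau>" "set q \<subseteq> exp_invariants B \<tau>" "length p = length q"
    and "eval p s = eval q s"
  shows "p = q"
  using assms(3,1,2,4)
proof (induction p q rule: list_induct2)
  case (Cons x xs y ys)
  have car: "x \<in> carrier B" "y \<in> carrier B" "eval xs s \<in> carrier B" "eval ys s \<in> carrier B"
    using Cons.prems by (auto intro!: eval_in_carrier)
  have "x \<otimes> c [^] length xs = y \<otimes> c [^] length xs"
    using tau_eval(2)[OF Cons.prems(1)] tau_eval(2)[OF Cons.prems(2)] Cons.prems(3) Cons.hyps by simp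
  moreover have "c [^] length xs \<otimes> (x \<ominus> y) = x \<otimes> c [^] length xs \<ominus> y \<otimes> c [^] length xs"
    using car nat_pow_closed[OF tau_closed[OF s_closed, of d], of "length xs"] by algebra
  ultimately have "c [^] length xs \<otimes> (x \<ominus> y) = \<zero>"
    using car by simp
  then have "x = y"
    using c_pow_cancel[of "x \<ominus> y" "length xs"] car by simp
  moreover have "eval xs s = eval ys s"
    using Cons.prems(3) Cons.hyps \<open>x = y\<close> car by simp
  then have "xs = ys"
    using Cons.IH Cons.prems by simp
  ultimately show ?case by simp
qed simp

lemma s_transcendental: "transcendental (exp_invariants B \<tau>) s"
proof -
  let ?K = "exp_invariants B \<tau>"
  \<comment> \<open>Polynomials are lists with nonzero head. A longer one would have a nonzero
    coefficient at \<open>d * (length p - 1)\<close>, where the value of the shorter one has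
    none.\<close>
  have length_le: "length p \<le> length q"
    if "polynomial ?K p" "polynomial ?K q" "eval p s = eval q s" for p q
  proof (rule ccontr)
    assume *: "\<not> length p \<le> length q"
    then have p: "set p \<subseteq> ?K" "hd p \<noteq> \<zero>" "p \<noteq> []" and q: "set q \<subseteq> ?K"
      using that by (auto simp: polynomial_def)
    have "d * length q \<le> d * (length p - 1)"
      using * by (intro mult_le_mono2) linarith
    then have "hd p \<otimes> c [^] (length p - 1) = \<zero>"
      using tau_eval(1)[OF q] tau_eval(2)[OF p(1,3)] that(3) by simp
    then have "hd p = \<zero>"
      using c_pow_cancel[of "hd p"] p(1,3) m_comm by (metis hd_in_set invariant_closed nat_pow_closed
          s_closed subsetD tau_closed)
    then show False
      using p by simp
  qed
  show ?thesis
    unfolding transcendental_def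
  proof (rule inj_onI)
    fix p q assume "p \<in> carrier (?K[X])" "q \<in> carrier (?K[X])" and eq: "eval p s = eval q s"
    then have pq: "polynomial ?K p" "polynomial ?K q"
      by (simp_all only: univ_poly_carrier)
    show "p = q"
      by (rule eval_eq_imp_eq[OF pq[THEN polynomial_incl] _ eq])
        (rule antisym[OF length_le[OF pq eq] length_le[OF pq(2,1) eq[symmetric]]])
  qed
qed

text \<open>If \<open>s \<ominus> e = p \<otimes> u\<close>, then \<open>u\<close> is a local slice
  with leading coefficient \<open>c'\<close> and \<open>c = p \<otimes> c'\<close>. Minimality
  forces \<open>c\<close> and \<open>c'\<close> to generate the same ideal of invariants; cancelling
  then makes \<open>p\<close> a unit, against \<open>proper\<close>.\<close>

lemma root_not_in_factor:
  assumes min: "minimal_local_slice B \<tau> s" and d: "exp_deg B \<tau> s = d"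
    and p: "p \<in> exp_invariants B \<tau>" "\<And>b. b \<in> carrier B \<Longrightarrow> p \<otimes> b = \<zero> \<Longrightarrow> b = \<zero>"
    and proper: "PIdl p \<noteq> carrier B"
    and e: "e \<in> exp_invariants B \<tau>"
  shows "s \<ominus> e \<notin> PIdl p"
proof
  assume "s \<ominus> e \<in> PIdl p"
  then obtain u where u: "u \<in> carrier B" "s \<ominus> e = p \<otimes> u"
    using p(1) m_comm by (auto simp: cgenideal_def)
  let ?I = "invariant_ring B \<tau>"
  interpret I: cring ?I
    by (rule invariant_ring_cring)
  \<comment> \<open>The invariant \<open>e\<close> affects the constant coefficient only.\<close>
  have tau_u: "p \<otimes> \<tau> u i = \<tau> s i" if "i > 0" for i
    using that u e p(1) tau_minus[of s e i] tau_invariant_mult[of p u i] invariantD[OF e that]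
    by (simp add: minus_eq)
  define c' where "c' = \<tau> u d"
  have c: "c = p \<otimes> c'"
    using tau_u d_pos by (simp add: c'_def)
  \<comment> \<open>A nonzero divisor is 0 only in the trivial ring, where no ideal is proper. This
    ensures that \<open>u\<close> has degree exactly \<open>d\<close>.\<close>
  have "c \<noteq> \<zero>"
  proof
    assume "c = \<zero>"
    then have "\<one> = \<zero>"
      using c_cancel[of \<one>] by simp
    then have "\<one> \<in> PIdl p"
      using p(1) additive_subgroup.zero_closed[OF ideal.axioms(1)[OF cgenideal_ideal[of p]]] by simp
    then show False
      using proper p(1) ideal.one_imp_carrier[OF cgenideal_ideal[of p]] by simp
  qed
  have above: "\<tau> u i = \<zero>" if "i > d" for i
    using that p(2)[of "\<tau> u i"] tau_u[of i] above_d[of i] u(1) by simp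
  have deg_u: "exp_deg B \<tau> u = d"
    using u above \<open>c \<noteq> \<zero>\<close> c p(1) by (intro exp_deg_eqI) (auto simp: c'_def)
  then have lc_u: "exp_lc B \<tau> u = c'"
    using u by (simp add: exp_lc_eq c'_def)
  then have c': "c' \<in> exp_invariants B \<tau>"
    using exp_lc_invariant[OF u(1)] by simp
  have "local_slice B \<tau> u"
    using min u deg_u d by (simp add: minimal_local_slice_def local_slice_def)
  then have "c' \<in> plinth_ideal B \<tau>"
    using lc_u by (auto simp: plinth_ideal_def)
  then have "\<not> PIdl\<^bsub>?I\<^esub> c \<subset> PIdl\<^bsub>?I\<^esub> c'"
    using min d by (auto simp: minimal_local_slice_def exp_lc_eq)
  moreover have "PIdl\<^bsub>?I\<^esub> c \<subseteq> PIdl\<^bsub>?I\<^esub> c'"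
  proof
    fix x assume "x \<in> PIdl\<^bsub>?I\<^esub> c"
    then obtain y where "y \<in> exp_invariants B \<tau>" "x = (y \<otimes> p) \<otimes> c'"
      using c c' p(1) by (auto simp: cgenideal_def m_assoc)
    then show "x \<in> PIdl\<^bsub>?I\<^esub> c'"
      using p(1) by (auto simp: cgenideal_def)
  qed
  moreover have "c' \<in> PIdl\<^bsub>?I\<^esub> c'"
    using I.cgenideal_self[of c'] c' by simp
  ultimately have "c' \<in> PIdl\<^bsub>?I\<^esub> c"
    by blast
  then obtain w where w: "w \<in> exp_invariants B \<tau>" "c' = w \<otimes> c"
    by (auto simp: cgenideal_def)
  have wpc: "w \<in> carrier B" "p \<in> carrier B" "c' \<in> carrier B"
    using w(1) p(1) c' by auto
  \<comment> \<open>Substituting \<open>c = p \<otimes> c'\<close> and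
    \<open>c' = w \<otimes> c\<close> gives a product with \<open>c\<close> that vanishes;
    cancelling \<open>c\<close> exhibits \<open>w\<close> as an inverse of \<open>p\<close>.\<close>
  have "c \<otimes> (\<one> \<ominus> w \<otimes> p) = p \<otimes> (c' \<ominus> w \<otimes> c)"
    unfolding c using wpc by algebra
  also have "\<dots> = \<zero>"
    using wpc by (subst w(2)[symmetric]) (simp add: minus_eq r_neg)
  finally have "\<one> \<ominus> w \<otimes> p = \<zero>"
    using wpc c_cancel[of "\<one> \<ominus> w \<otimes> p"] by simp
  then have "\<one> = w \<otimes> p"
    using wpc by simp
  then have "\<one> \<in> PIdl p"
    using wpc by (auto simp: cgenideal_def)
  then show False
    using proper ideal.one_imp_carrier[OF cgenideal_ideal] wpc by blast
qed

lemma factor_cancel: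
  assumes L: "algebraically_closed L" and \<eta>: "\<eta> \<in> ring_hom L B"
    and p: "p \<in> exp_invariants B \<tau>" "\<And>b. b \<in> carrier B \<Longrightarrow> p \<otimes> b = \<zero> \<Longrightarrow> b = \<zero>"
    and prime: "primeideal (PIdl p) B"
    and residue: "\<And>a. a \<in> exp_invariants B \<tau> \<Longrightarrow>
        \<exists>\<mu>\<in>carrier L. \<exists>a'\<in>exp_invariants B \<tau>. a = \<eta> \<mu> \<oplus> p \<otimes> a'"
    and no_root: "\<And>\<mu>. \<mu> \<in> carrier L \<Longrightarrow> s \<ominus> \<eta> \<mu> \<notin> PIdl p"
    and b: "b \<in> carrier B" "p \<otimes> b \<in> Inv_s"
  shows "b \<in> Inv_s"
proof -
  interpret L: algebraically_closed L by fact
  interpret UL: UP_cring L "UP L" by unfold_locales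
  interpret E: UP_pre_univ_prop L B \<eta> "UP L"
    using UP_pre_univ_propI[OF L.is_cring is_cring \<eta>] .
  interpret ev: ring_hom_cring "UP L" B "UnivPoly.eval L B \<eta> s"
    by (intro ring_hom_cringI UL.UP_cring is_cring E.eval_ring_hom s_closed)
  \<comment> \<open>Reduction modulo \<open>p\<close>, coefficient by coefficient:
    \<open>residue\<close> replaces every invariant coefficient by a constant from \<open>L\<close>,
    and the error terms collect in \<open>w\<close>.\<close>
  have "\<exists>f\<in>carrier (UP L). \<exists>w\<in>Inv_s. a = UnivPoly.eval L B \<eta> s f \<oplus> p \<otimes> w" if "a \<in> Inv_s" for a
    using that
  proof (induction a rule: simple_extension.induct)
    case zero
    then show ?case
      using p(1) by (intro bexI[of _ "\<zero>\<^bsub>UP L\<^esub>"] bexI[of _ \<zero>]) auto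
  next
    case (lin a k)
    then obtain f w where f: "f \<in> carrier (UP L)" "w \<in> Inv_s" "a = UnivPoly.eval L B \<eta> s f \<oplus> p \<otimes> w"
      by blast
    obtain \<mu> k' where k: "\<mu> \<in> carrier L" "k' \<in> exp_invariants B \<tau>" "k = \<eta> \<mu> \<oplus> p \<otimes> k'"
      using residue[OF lin.hyps(2)] by blast
    \<comment> \<open>The Horner step \<open>a \<otimes> s \<oplus> k\<close> on the side of
      \<open>L\<close>: multiply \<open>f\<close> by the variable and add the constant
      \<mu>.\<close>
    define g where "g = f \<otimes>\<^bsub>UP L\<^esub> up_ring.monom (UP L) \<one>\<^bsub>L\<^esub> 1 \<oplus>\<^bsub>UP L\<^esub> up_ring.monom (UP L) \<mu> 0"
    have g: "g \<in> carrier (UP L)"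
      using f k by (simp add: g_def)
    have ev_g: "UnivPoly.eval L B \<eta> s g = UnivPoly.eval L B \<eta> s f \<otimes> s \<oplus> \<eta> \<mu>"
      using f k E.eval_monom1[OF s_closed] E.eval_const[OF s_closed k(1)] by (simp add: g_def)
    have "w \<otimes> s \<oplus> k' \<in> Inv_s"
      using f k by (intro simple_extension.lin)
    moreover have "a \<otimes> s \<oplus> k = UnivPoly.eval L B \<eta> s g \<oplus> p \<otimes> (w \<otimes> s \<oplus> k')"
    proof -
      have "UnivPoly.eval L B \<eta> s f \<in> carrier B" "w \<in> carrier B" "k' \<in> carrier B" "p \<in> carrier B"
          "\<eta> \<mu> \<in> carrier B"
        using f(1,2) k(1,2) p(1) Inv_s_closed ring_hom_closed[OF \<eta>] by auto
      then show ?thesis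
        unfolding ev_g f(3) k(3) using s_closed by algebra
    qed
    ultimately show ?case
      using g by blast
  qed
  then obtain f w where f: "f \<in> carrier (UP L)" "w \<in> Inv_s"
      "p \<otimes> b = UnivPoly.eval L B \<eta> s f \<oplus> p \<otimes> w"
    using b by blast
  have car: "p \<in> carrier B" "w \<in> carrier B" "UnivPoly.eval L B \<eta> s f \<in> carrier B"
    using p(1) f(1,2) Inv_s_closed by auto
  have eq: "p \<otimes> (b \<ominus> w) = UnivPoly.eval L B \<eta> s f"
  proof -
    have "p \<otimes> (b \<ominus> w) = p \<otimes> b \<ominus> p \<otimes> w"
      using car b by algebra
    also have "\<dots> = UnivPoly.eval L B \<eta> s f"
      unfolding f(3) using car by algebra
    finally show ?thesis .
  qed
  have "(b \<ominus> w) \<otimes> p \<in> PIdl p"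
    using car b by (auto simp: cgenideal_def)
  then have "UnivPoly.eval L B \<eta> s f \<in> PIdl p"
    using eq car b m_comm by simp
  \<comment> \<open>Otherwise \<open>root_in_prime\<close> would produce a constant \<mu> that
    \<open>no_root\<close> excludes.\<close>
  then have "f = \<zero>\<^bsub>UP L\<^esub>"
    using L.root_in_prime[OF is_cring \<eta> prime s_closed f(1)] no_root by blast
  then have "b \<ominus> w = \<zero>"
    using eq car b p(2)[of "b \<ominus> w"] by simp
  then have "b = w"
    using b car by simp
  then show ?thesis
    using f by simp
qed

end

section \<open>The tensor product\<close>

context
  fixes L :: "('l, 'm) ring_scheme" and A :: "('a, 'n) ring_scheme"
  assumes L: "cring L" and A: "cring A"
begin

interpretation L: cring L by (rule L)
interpretation A: cring A by (rule A)

lemma pair_ring_carrier: "u \<in> carrier (pair_ring L A) \<longleftrightarrow> Poly_Mapping.keys u \<subseteq> carrier L \<times> carrier A"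
  by (simp add: pair_ring_def)

lemma pair_ring_simps:
  "\<zero>\<^bsub>pair_ring L A\<^esub> = 0" "u \<oplus>\<^bsub>pair_ring L A\<^esub> v = u + v"
  "\<one>\<^bsub>pair_ring L A\<^esub> = frag_of (\<one>\<^bsub>L\<^esub>, \<one>\<^bsub>A\<^esub>)"
  by (simp_all add: pair_ring_def)

lemma pair_ring_diff_closed:
  "u \<in> carrier (pair_ring L A) \<Longrightarrow> v \<in> carrier (pair_ring L A) \<Longrightarrow> u - v \<in> carrier (pair_ring L A)"
  using keys_diff[of u v] by (auto simp: pair_ring_carrier)

lemma pair_ring_frag_of [simp]:
  "l \<in> carrier L \<Longrightarrow> a \<in> carrier A \<Longrightarrow> frag_of (l, a) \<in> carrier (pair_ring L A)"
  by (simp add: pair_ring_carrier)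

lemma pair_ring_zero [simp]: "0 \<in> carrier (pair_ring L A)"
  by (simp add: pair_ring_carrier)

text \<open>Basis elements generate the free abelian group by subtraction alone, so identities that
  respect differences need checking only on pairs.\<close>

lemma pair_ring_induct [consumes 1, case_names zero single diff]:
  assumes "u \<in> carrier (pair_ring L A)" and "P 0"
    and "\<And>l a. l \<in> carrier L \<Longrightarrow> a \<in> carrier A \<Longrightarrow> P (frag_of (l, a))"
    and "\<And>u v. u \<in> carrier (pair_ring L A) \<Longrightarrow> v \<in> carrier (pair_ring L A) \<Longrightarrow> P u \<Longrightarrow> P v \<Longrightarrow> P (u - v)"
  shows "P u"
proof -
  have "u \<in> carrier (pair_ring L A) \<and> P u"
    using assms(1)[unfolded pair_ring_carrier]
  proof (induction u rule: frag_induction)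
    case (one x)
    then show ?case using assms(3) by (cases x) auto
  next
    case (diff a b)
    then show ?case using assms(4) pair_ring_diff_closed by blast
  qed (use assms(2) in auto)
  then show ?thesis ..
qed

lemma pair_ring_mult_single:
  "frag_of (l, a) \<otimes>\<^bsub>pair_ring L A\<^esub> frag_of (l', a') = frag_of (l \<otimes>\<^bsub>L\<^esub> l', a \<otimes>\<^bsub>A\<^esub> a')"
  by (simp add: pair_ring_def)

lemma pair_ring_mult_zero: "0 \<otimes>\<^bsub>pair_ring L A\<^esub> v = 0" "u \<otimes>\<^bsub>pair_ring L A\<^esub> 0 = 0"
  by (simp_all add: pair_ring_def frag_extend_eq_0 split: prod.split)

lemma pair_ring_mult_diff_left:
  "(u - u') \<otimes>\<^bsub>pair_ring L A\<^esub> v = u \<otimes>\<^bsub>pair_ring L A\<^esub> v - u' \<otimes>\<^bsub>pair_ring L A\<^esub> v"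
  by (simp add: pair_ring_def frag_extend_diff)

lemma pair_ring_mult_diff_right:
  "u \<otimes>\<^bsub>pair_ring L A\<^esub> (v - v') = u \<otimes>\<^bsub>pair_ring L A\<^esub> v - u \<otimes>\<^bsub>pair_ring L A\<^esub> v'"
proof -
  \<comment> \<open>The product extends over \<open>u\<close> outside and over \<open>v\<close>
    inside, so linearity in \<open>v\<close> is linearity of \<open>frag_extend\<close> in the
    function being extended.\<close>
  have *: "frag_extend (\<lambda>x. f x - g x) u = frag_extend f u - frag_extend g u"
    for f g :: "'l \<times> 'a \<Rightarrow> ('l \<times> 'a \<Rightarrow>\<^sub>0 int)"
  proof -
    have "frag_cmul k (p - q) = frag_cmul k p - frag_cmul k q" for k and p q :: "'l \<times> 'a \<Rightarrow>\<^sub>0 int"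
      by (simp add: poly_mapping_eqI lookup_minus right_diff_distrib)
    then show ?thesis
      by (simp add: frag_extend_def sum_subtractf)
  qed
  show ?thesis
    by (simp add: pair_ring_def frag_extend_diff case_prod_unfold *)
qed

lemma pair_ring_mult_closed:
  assumes "u \<in> carrier (pair_ring L A)" "v \<in> carrier (pair_ring L A)"
  shows "u \<otimes>\<^bsub>pair_ring L A\<^esub> v \<in> carrier (pair_ring L A)"
  using assms(1)
proof (induction u rule: pair_ring_induct)
  case (single l a)
  show ?case
    using assms(2)
    by (induction v rule: pair_ring_induct)
      (auto simp: single pair_ring_mult_single pair_ring_mult_zero pair_ring_mult_diff_right
        pair_ring_diff_closed)
qed (auto simp: pair_ring_mult_zero pair_ring_mult_diff_left pair_ring_diff_closed)

lemma pair_ring_mult_comm: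
  assumes "u \<in> carrier (pair_ring L A)" "v \<in> carrier (pair_ring L A)"
  shows "u \<otimes>\<^bsub>pair_ring L A\<^esub> v = v \<otimes>\<^bsub>pair_ring L A\<^esub> u"
  using assms(1)
proof (induction u rule: pair_ring_induct)
  case (single l a)
  show ?case
    using assms(2)
    by (induction v rule: pair_ring_induct)
      (auto simp: single pair_ring_mult_single pair_ring_mult_zero pair_ring_mult_diff_right
        pair_ring_mult_diff_left L.m_comm A.m_comm)
qed (auto simp: pair_ring_mult_zero pair_ring_mult_diff_left pair_ring_mult_diff_right)

lemma pair_ring_mult_assoc:
  assumes "u \<in> carrier (pair_ring L A)" "v \<in> carrier (pair_ring L A)" "w \<in> carrier (pair_ring L A)"
  shows "(u \<otimes>\<^bsub>pair_ring L A\<^esub> v) \<otimes>\<^bsub>pair_ring L A\<^esub> w = u \<otimes>\<^bsub>pair_ring L A\<^esub> (v \<otimes>\<^bsub>pair_ring L A\<^esub> w)"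
  using assms(1)
proof (induction u rule: pair_ring_induct)
  case u: (single l a)
  show ?case
    using assms(2)
  proof (induction v rule: pair_ring_induct)
    case v: (single l' a')
    show ?case
      using assms(3)
      by (induction w rule: pair_ring_induct)
        (auto simp: u v pair_ring_mult_single pair_ring_mult_zero pair_ring_mult_diff_right
          L.m_assoc A.m_assoc)
  qed (auto simp: pair_ring_mult_zero pair_ring_mult_diff_left pair_ring_mult_diff_right)
qed (auto simp: pair_ring_mult_zero pair_ring_mult_diff_left)

lemma pair_ring_cring: "cring (pair_ring L A)"
proof (rule cringI)
  show "abelian_group (pair_ring L A)"
  proof (rule abelian_groupI)
    fix x assume x: "x \<in> carrier (pair_ring L A)"
    then show "\<exists>y\<in>carrier (pair_ring L A). y \<oplus>\<^bsub>pair_ring L A\<^esub> x = \<zero>\<^bsub>pair_ring L A\<^esub>"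
      using pair_ring_diff_closed[of 0 x] by (intro bexI[of _ "0 - x"]) (auto simp: pair_ring_simps)
    fix y assume y: "y \<in> carrier (pair_ring L A)"
    show "x \<oplus>\<^bsub>pair_ring L A\<^esub> y \<in> carrier (pair_ring L A)"
      using x y keys_add[of x y] by (auto simp: pair_ring_simps pair_ring_carrier)
  qed (auto simp: pair_ring_simps add_ac)
  show "comm_monoid (pair_ring L A)"
  proof (rule comm_monoidI)
    fix x assume "x \<in> carrier (pair_ring L A)"
    then show "\<one>\<^bsub>pair_ring L A\<^esub> \<otimes>\<^bsub>pair_ring L A\<^esub> x = x"
      by (induction x rule: pair_ring_induct)
        (auto simp: pair_ring_simps pair_ring_mult_single pair_ring_mult_zero pair_ring_mult_diff_right)
  qed (simp_all add: pair_ring_mult_closed pair_ring_mult_assoc, simp add: pair_ring_simps,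
      rule pair_ring_mult_comm)
  fix x y z
  \<comment> \<open>Distributivity over sums follows from the law for differences, by x + y = x - (0
    - y).\<close>
  have "(x - (0 - y)) \<otimes>\<^bsub>pair_ring L A\<^esub> z = x \<otimes>\<^bsub>pair_ring L A\<^esub> z - (0 - y \<otimes>\<^bsub>pair_ring L A\<^esub> z)"
    by (simp only: pair_ring_mult_diff_left pair_ring_mult_zero)
  then show "(x \<oplus>\<^bsub>pair_ring L A\<^esub> y) \<otimes>\<^bsub>pair_ring L A\<^esub> z =
      x \<otimes>\<^bsub>pair_ring L A\<^esub> z \<oplus>\<^bsub>pair_ring L A\<^esub> y \<otimes>\<^bsub>pair_ring L A\<^esub> z"
    by (simp add: pair_ring_simps)
qed

lemma pair_ring_minus:
  assumes "u \<in> carrier (pair_ring L A)" "v \<in> carrier (pair_ring L A)"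
  shows "u \<ominus>\<^bsub>pair_ring L A\<^esub> v = u - v"
proof -
  interpret R: cring "pair_ring L A" by (rule pair_ring_cring)
  have "\<ominus>\<^bsub>pair_ring L A\<^esub> v = 0 - v"
    using assms pair_ring_diff_closed[of 0 v] by (intro R.minus_equality) (auto simp: pair_ring_simps)
  then show ?thesis
    by (simp add: R.minus_eq pair_ring_simps)
qed

end

section \<open>The quotient by the tensor relations and its universal property\<close>

locale scalar_extension = L: field L + K: subfield K L + A: cring A
  for L :: "('l, 'm) ring_scheme" and K and A :: "('l, 'a, 'n) module_scheme" +
  assumes alg: "algebra (L\<lparr>carrier := K\<rparr>) A"
begin

abbreviation "R \<equiv> pair_ring L A"
abbreviation "T \<equiv> tensor_ideal L K A"
abbreviation "LA \<equiv> base_change L K A"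
abbreviation "pt \<equiv> pure_tensor L K A"

sublocale R: cring R
  by (rule pair_ring_cring[OF L.is_cring A.is_cring])

lemmas R_induct [consumes 1, case_names zero single diff] = pair_ring_induct[OF L.is_cring A.is_cring]
lemmas R_minus = pair_ring_minus[OF L.is_cring A.is_cring]
lemmas R_diff_closed = pair_ring_diff_closed[OF L.is_cring A.is_cring]
lemmas R_frag_of [simp] = pair_ring_frag_of[OF L.is_cring A.is_cring]
lemmas R_mult_single = pair_ring_mult_single[OF L.is_cring A.is_cring]
lemmas R_mult_zero = pair_ring_mult_zero[OF L.is_cring A.is_cring]
lemmas R_mult_diff_left = pair_ring_mult_diff_left[OF L.is_cring A.is_cring]
lemmas R_mult_diff_right = pair_ring_mult_diff_right[OF L.is_cring A.is_cring]
lemmas R_simps = pair_ring_simps[OF L.is_cring A.is_cring]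

lemma R_0 [simp]: "0 \<in> carrier R"
  by (rule pair_ring_zero[OF L.is_cring A.is_cring])

lemma K_closed [simp]: "c \<in> K \<Longrightarrow> c \<in> carrier L"
  using K.subset by auto

lemma smult_closed [simp]: "c \<in> K \<Longrightarrow> a \<in> carrier A \<Longrightarrow> c \<odot>\<^bsub>A\<^esub> a \<in> carrier A"
  using module.smult_closed[OF algebra.axioms(1)[OF alg]] by simp

lemma smult_mult: "c \<in> K \<Longrightarrow> a \<in> carrier A \<Longrightarrow> b \<in> carrier A \<Longrightarrow>
    (c \<odot>\<^bsub>A\<^esub> a) \<otimes>\<^bsub>A\<^esub> b = c \<odot>\<^bsub>A\<^esub> (a \<otimes>\<^bsub>A\<^esub> b)"
  using algebra.smult_assoc2[OF alg] by simp

lemma tensor_relations_closed: "tensor_relations L K A \<subseteq> carrier R"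
  unfolding tensor_relations_def by (auto intro!: R_diff_closed)

lemma tensor_relations_cases:
  assumes "r \<in> tensor_relations L K A"
  obtains (left) l l' a where "l \<in> carrier L" "l' \<in> carrier L" "a \<in> carrier A"
      "r = frag_of (l \<oplus>\<^bsub>L\<^esub> l', a) - frag_of (l, a) - frag_of (l', a)"
  | (right) l a a' where "l \<in> carrier L" "a \<in> carrier A" "a' \<in> carrier A"
      "r = frag_of (l, a \<oplus>\<^bsub>A\<^esub> a') - frag_of (l, a) - frag_of (l, a')"
  | (bal) l c a where "l \<in> carrier L" "c \<in> K" "a \<in> carrier A"
      "r = frag_of (l \<otimes>\<^bsub>L\<^esub> c, a) - frag_of (l, c \<odot>\<^bsub>A\<^esub> a)"
  using assms unfolding tensor_relations_def by (elim UnE CollectE exE conjE) metis+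

lemma relation_mult_single:
  assumes "r \<in> tensor_relations L K A" "m \<in> carrier L" "b \<in> carrier A"
  shows "r \<otimes>\<^bsub>R\<^esub> frag_of (m, b) \<in> tensor_relations L K A"
  using assms(1)
proof (cases rule: tensor_relations_cases)
  case (left l l' a)
  then have "r \<otimes>\<^bsub>R\<^esub> frag_of (m, b) = frag_of (l \<otimes>\<^bsub>L\<^esub> m \<oplus>\<^bsub>L\<^esub> l' \<otimes>\<^bsub>L\<^esub> m, a \<otimes>\<^bsub>A\<^esub> b)
      - frag_of (l \<otimes>\<^bsub>L\<^esub> m, a \<otimes>\<^bsub>A\<^esub> b) - frag_of (l' \<otimes>\<^bsub>L\<^esub> m, a \<otimes>\<^bsub>A\<^esub> b)"
    using assms by (simp add: R_mult_diff_left R_mult_single L.l_distr)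
  moreover have "l \<otimes>\<^bsub>L\<^esub> m \<in> carrier L" "l' \<otimes>\<^bsub>L\<^esub> m \<in> carrier L" "a \<otimes>\<^bsub>A\<^esub> b \<in> carrier A"
    using left assms by auto
  ultimately show ?thesis
    unfolding tensor_relations_def by blast
next
  case (right l a a')
  then have "r \<otimes>\<^bsub>R\<^esub> frag_of (m, b) = frag_of (l \<otimes>\<^bsub>L\<^esub> m, a \<otimes>\<^bsub>A\<^esub> b \<oplus>\<^bsub>A\<^esub> a' \<otimes>\<^bsub>A\<^esub> b)
      - frag_of (l \<otimes>\<^bsub>L\<^esub> m, a \<otimes>\<^bsub>A\<^esub> b) - frag_of (l \<otimes>\<^bsub>L\<^esub> m, a' \<otimes>\<^bsub>A\<^esub> b)"
    using assms by (simp add: R_mult_diff_left R_mult_single A.l_distr)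
  moreover have "l \<otimes>\<^bsub>L\<^esub> m \<in> carrier L" "a \<otimes>\<^bsub>A\<^esub> b \<in> carrier A" "a' \<otimes>\<^bsub>A\<^esub> b \<in> carrier A"
    using right assms by auto
  ultimately show ?thesis
    unfolding tensor_relations_def by blast
next
  case (bal l c a)
  have "l \<otimes>\<^bsub>L\<^esub> c \<otimes>\<^bsub>L\<^esub> m = l \<otimes>\<^bsub>L\<^esub> m \<otimes>\<^bsub>L\<^esub> c"
    using L.m_assoc[of l c m] L.m_assoc[of l m c] L.m_comm[of c m] bal(1,2) assms(2) by simp
  then have "r \<otimes>\<^bsub>R\<^esub> frag_of (m, b) =
      frag_of ((l \<otimes>\<^bsub>L\<^esub> m) \<otimes>\<^bsub>L\<^esub> c, a \<otimes>\<^bsub>A\<^esub> b) - frag_of (l \<otimes>\<^bsub>L\<^esub> m, c \<odot>\<^bsub>A\<^esub> (a \<otimes>\<^bsub>A\<^esub> b))"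
    using bal assms by (simp add: R_mult_diff_left R_mult_single smult_mult)
  moreover have "l \<otimes>\<^bsub>L\<^esub> m \<in> carrier L" "a \<otimes>\<^bsub>A\<^esub> b \<in> carrier A"
    using bal assms by auto
  ultimately show ?thesis
    using bal(2) unfolding tensor_relations_def by blast
qed

sublocale T: ideal T R
  unfolding tensor_ideal_def by (rule R.genideal_ideal[OF tensor_relations_closed])

lemma relation_in_T: "r \<in> tensor_relations L K A \<Longrightarrow> r \<in> T"
  unfolding tensor_ideal_def using R.genideal_self[OF tensor_relations_closed] by blast

text \<open>Although \<open>T\<close> is generated as an ideal, it is reached from the relations by
  subtraction alone. Additive maps can thus be shown to vanish on \<open>T\<close>.\<close>

lemma tensor_ideal_induct [consumes 1, case_names zero relation diff]:
  assumes "u \<in> T" and "P 0" and "\<And>r. r \<in> tensor_relations L K A \<Longrightarrow> P r"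
    and "\<And>u v. u \<in> carrier R \<Longrightarrow> v \<in> carrier R \<Longrightarrow> P u \<Longrightarrow> P v \<Longrightarrow> P (u - v)"
  shows "P u"
proof -
  \<comment> \<open>Demanding \<open>P\<close> for all multiples makes \<open>J\<close> an ideal. It
    contains the relations because a relation times a basis element is a relation; multiplying by
    one at the end recovers \<open>P u\<close>.\<close>
  define J where "J = {u \<in> carrier R. \<forall>v\<in>carrier R. P (u \<otimes>\<^bsub>R\<^esub> v)}"
  have J_diff: "u - u' \<in> J" if "u \<in> J" "u' \<in> J" for u u'
    using that R_diff_closed assms(4) by (simp add: J_def R_mult_diff_left)
  have J_zero: "0 \<in> J"
    using assms(2) by (simp add: J_def R_mult_zero)
  have J_neg: "\<ominus>\<^bsub>R\<^esub> u \<in> J" if u: "u \<in> J" for u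
  proof -
    have "\<ominus>\<^bsub>R\<^esub> u = \<zero>\<^bsub>R\<^esub> \<ominus>\<^bsub>R\<^esub> u"
      using u by (simp add: J_def R.minus_eq)
    also have "\<dots> = 0 - u"
      using u R_minus[of 0 u] by (simp add: J_def R_simps)
    finally show ?thesis
      using J_diff[OF J_zero u] by simp
  qed
  have J_add: "u \<oplus>\<^bsub>R\<^esub> v \<in> J" if "u \<in> J" "v \<in> J" for u v
  proof -
    have "u - \<ominus>\<^bsub>R\<^esub> v = u \<oplus>\<^bsub>R\<^esub> v"
      using that R_minus[of u "\<ominus>\<^bsub>R\<^esub> v"] by (simp add: J_def R.minus_eq)
    then show ?thesis
      using J_diff[OF that(1) J_neg[OF that(2)]] by simp
  qed
  have mult: "x \<otimes>\<^bsub>R\<^esub> a \<in> J" if "a \<in> J" "x \<in> carrier R" for a x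
    using that by (auto simp: J_def R.m_comm[of x] R.m_assoc)
  have "ideal J R"
  proof (rule idealI[OF R.ring_axioms])
    show "subgroup J (add_monoid R)"
    proof (rule subgroup.intro)
      fix u assume "u \<in> J"
      then show "inv\<^bsub>add_monoid R\<^esub> u \<in> J"
        using J_neg by (simp add: a_inv_def)
    qed (use J_add J_zero in \<open>auto simp: R_simps J_def\<close>)
    show "a \<otimes>\<^bsub>R\<^esub> x \<in> J" if "a \<in> J" "x \<in> carrier R" for a x
      using mult[OF that] that R.m_comm[of a x] by (simp add: J_def)
  qed (rule mult)
  moreover have "tensor_relations L K A \<subseteq> J"
  proof
    fix r assume r: "r \<in> tensor_relations L K A"
    have "P (r \<otimes>\<^bsub>R\<^esub> v)" if "v \<in> carrier R" for v
      using that
    proof (induction v rule: R_induct)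
      case (diff v w)
      have "r \<in> carrier R"
        using r tensor_relations_closed by blast
      then show ?case
        using diff assms(4) by (simp add: R_mult_diff_right)
    qed (use r assms(2,3) relation_mult_single in \<open>auto simp: R_mult_zero\<close>)
    then show "r \<in> J"
      using r tensor_relations_closed by (auto simp: J_def)
  qed
  ultimately have "T \<subseteq> J"
    unfolding tensor_ideal_def by (rule R.genideal_minimal)
  then have "u \<in> carrier R" "P (u \<otimes>\<^bsub>R\<^esub> \<one>\<^bsub>R\<^esub>)"
    using assms(1) R.one_closed unfolding J_def by blast+
  then show ?thesis by simp
qed

abbreviation cls where "cls u \<equiv> T +>\<^bsub>R\<^esub> u"

sublocale LA: cring LA
  unfolding base_change_def by (rule T.quotient_is_cring[OF R.is_cring])

lemma cls_hom: "(\<lambda>u. cls u) \<in> ring_hom R LA"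
  unfolding base_change_def by (rule T.rcos_ring_hom)

sublocale cls: ring_hom_ring R LA cls
  by (intro ring_hom_ringI2 R.ring_axioms LA.ring_axioms cls_hom)

lemma LA_carrier: "carrier LA = cls ` carrier R"
  unfolding base_change_def FactRing_def A_RCOSETS_def' by simp blast

lemma cls_eq_iff: "u \<in> carrier R \<Longrightarrow> v \<in> carrier R \<Longrightarrow> cls u = cls v \<longleftrightarrow> u - v \<in> T"
  using R.quotient_eq_iff_same_a_r_cos[OF T.is_ideal, of u v] by (simp add: R_minus)

lemma cls_diff: "u \<in> carrier R \<Longrightarrow> v \<in> carrier R \<Longrightarrow> cls (u - v) = cls u \<ominus>\<^bsub>LA\<^esub> cls v"
  by (simp add: R.minus_eq LA.minus_eq flip: R_minus)

lemma cls_0: "cls 0 = \<zero>\<^bsub>LA\<^esub>"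
  using cls.hom_zero by (simp add: R_simps)

lemma pt_closed [simp]: "l \<in> carrier L \<Longrightarrow> a \<in> carrier A \<Longrightarrow> pt l a \<in> carrier LA"
  by (simp add: pure_tensor_def)

lemma LA_induct [consumes 1, case_names zero pure diff]:
  assumes "x \<in> carrier LA" and "P \<zero>\<^bsub>LA\<^esub>"
    and "\<And>l a. l \<in> carrier L \<Longrightarrow> a \<in> carrier A \<Longrightarrow> P (pt l a)"
    and "\<And>x y. x \<in> carrier LA \<Longrightarrow> y \<in> carrier LA \<Longrightarrow> P x \<Longrightarrow> P y \<Longrightarrow> P (x \<ominus>\<^bsub>LA\<^esub> y)"
  shows "P x"
proof -
  obtain u where u: "u \<in> carrier R" "x = cls u"
    using assms(1) by (auto simp: LA_carrier)
  have "P (cls u)"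
    using u(1)
    by (induction u rule: R_induct)
      (use assms(2-4) in \<open>auto simp: cls_0 cls_diff pure_tensor_def\<close>)
  then show ?thesis
    using u by simp
qed

lemma pt_mult:
  "l \<in> carrier L \<Longrightarrow> l' \<in> carrier L \<Longrightarrow> a \<in> carrier A \<Longrightarrow> a' \<in> carrier A \<Longrightarrow>
    pt l a \<otimes>\<^bsub>LA\<^esub> pt l' a' = pt (l \<otimes>\<^bsub>L\<^esub> l') (a \<otimes>\<^bsub>A\<^esub> a')"
  unfolding pure_tensor_def by (simp add: R_mult_single flip: cls.hom_mult)

lemma pt_one: "pt \<one>\<^bsub>L\<^esub> \<one>\<^bsub>A\<^esub> = \<one>\<^bsub>LA\<^esub>"
  unfolding pure_tensor_def using cls.hom_one by (simp add: R_simps)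

lemma cls_relation:
  assumes "u \<in> carrier R" "v \<in> carrier R" "w \<in> carrier R" "u - v - w \<in> tensor_relations L K A"
  shows "cls u = cls v \<oplus>\<^bsub>LA\<^esub> cls w"
proof -
  have "u - (v + w) \<in> T"
    using relation_in_T[OF assms(4)] by (simp add: diff_diff_eq)
  moreover have "v + w \<in> carrier R" "cls (v + w) = cls v \<oplus>\<^bsub>LA\<^esub> cls w"
    using R.a_closed[OF assms(2,3)] cls.hom_add[OF assms(2,3)] by (simp_all add: R_simps)
  ultimately show ?thesis
    using assms(1) by (simp flip: cls_eq_iff)
qed

lemma pt_add_left:
  assumes "l \<in> carrier L" "l' \<in> carrier L" "a \<in> carrier A"
  shows "pt (l \<oplus>\<^bsub>L\<^esub> l') a = pt l a \<oplus>\<^bsub>LA\<^esub> pt l' a"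
  unfolding pure_tensor_def
  by (rule cls_relation) (use assms in \<open>auto simp: tensor_relations_def\<close>)

lemma pt_add_right:
  assumes "l \<in> carrier L" "a \<in> carrier A" "a' \<in> carrier A"
  shows "pt l (a \<oplus>\<^bsub>A\<^esub> a') = pt l a \<oplus>\<^bsub>LA\<^esub> pt l a'"
  unfolding pure_tensor_def
  by (rule cls_relation) (use assms in \<open>auto simp: tensor_relations_def\<close>)

lemma pt_zero_right: "l \<in> carrier L \<Longrightarrow> pt l \<zero>\<^bsub>A\<^esub> = \<zero>\<^bsub>LA\<^esub>"
  using pt_add_right[of l "\<zero>\<^bsub>A\<^esub>" "\<zero>\<^bsub>A\<^esub>"] LA.add.r_cancel_one'[of "pt l \<zero>\<^bsub>A\<^esub>" "pt l \<zero>\<^bsub>A\<^esub>"] by simp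

lemma pt_left_hom: "(\<lambda>l. pt l \<one>\<^bsub>A\<^esub>) \<in> ring_hom L LA"
  by (rule ring_hom_memI) (auto simp: pt_mult pt_add_left pt_one)

lemma pt_finsum:
  assumes "l \<in> carrier L" "\<And>i. i \<in> I \<Longrightarrow> f i \<in> carrier A"
  shows "pt l (\<Oplus>\<^bsub>A\<^esub>i\<in>I. f i) = (\<Oplus>\<^bsub>LA\<^esub>i\<in>I. pt l (f i))"
  using assms(2)
proof (induction I rule: infinite_finite_induct)
  case (insert i I)
  then show ?case
    using assms(1) by (simp add: pt_add_right Pi_def)
qed (use assms(1) in \<open>auto simp: pt_zero_right\<close>)

lemma pt_add_pow:
  assumes "l \<in> carrier L" "a \<in> carrier A"
  shows "pt l (add_pow A (n::nat) a) = add_pow LA n (pt l a)"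
  by (induction n) (use assms in \<open>auto simp: pt_zero_right pt_add_right\<close>)

text \<open>Freeness gives \<open>h\<close> on formal sums; it kills each relation, hence
  \<open>T\<close>. Additivity is expressed through differences to fit
  \<open>LA_induct\<close>.\<close>

lemma universal_property:
  assumes G: "abelian_group G"
    and closed: "\<And>l a. l \<in> carrier L \<Longrightarrow> a \<in> carrier A \<Longrightarrow> g l a \<in> carrier G"
    and left: "\<And>l l' a. l \<in> carrier L \<Longrightarrow> l' \<in> carrier L \<Longrightarrow> a \<in> carrier A \<Longrightarrow>
        g (l \<oplus>\<^bsub>L\<^esub> l') a = g l a \<oplus>\<^bsub>G\<^esub> g l' a"
    and right: "\<And>l a a'. l \<in> carrier L \<Longrightarrow> a \<in> carrier A \<Longrightarrow> a' \<in> carrier A \<Longrightarrow>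
        g l (a \<oplus>\<^bsub>A\<^esub> a') = g l a \<oplus>\<^bsub>G\<^esub> g l a'"
    and bal: "\<And>l c a. l \<in> carrier L \<Longrightarrow> c \<in> K \<Longrightarrow> a \<in> carrier A \<Longrightarrow>
        g (l \<otimes>\<^bsub>L\<^esub> c) a = g l (c \<odot>\<^bsub>A\<^esub> a)"
  obtains F where "\<And>x. x \<in> carrier LA \<Longrightarrow> F x \<in> carrier G"
    and "\<And>x y. x \<in> carrier LA \<Longrightarrow> y \<in> carrier LA \<Longrightarrow> F (x \<ominus>\<^bsub>LA\<^esub> y) = F x \<ominus>\<^bsub>G\<^esub> F y"
    and "\<And>l a. l \<in> carrier L \<Longrightarrow> a \<in> carrier A \<Longrightarrow> F (pt l a) = g l a"
proof -
  interpret G: abelian_group G by fact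
  let ?F = "free_Abelian_group (carrier L \<times> carrier A)"
  have "case_prod g ` (carrier L \<times> carrier A) \<subseteq> carrier (add_monoid G)"
    using closed by auto
  then obtain h where h: "h \<in> hom ?F (add_monoid G)"
    "\<And>x. x \<in> carrier L \<times> carrier A \<Longrightarrow> h (frag_of x) = case_prod g x"
    using comm_group.free_Abelian_group_universal[OF G.a_comm_group] by metis
  have car: "u \<in> carrier ?F \<longleftrightarrow> u \<in> carrier R" for u
    by (simp add: pair_ring_carrier[OF L.is_cring A.is_cring])
  have h_closed: "h u \<in> carrier G" if "u \<in> carrier R" for u
    using hom_in_carrier[OF h(1), of u] that car by simp
  have h_add: "h (u + v) = h u \<oplus>\<^bsub>G\<^esub> h v" if "u \<in> carrier R" "v \<in> carrier R" for u v
    using hom_mult[OF h(1), of u v] that car by simp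
  have h_diff: "h (u - v) = h u \<ominus>\<^bsub>G\<^esub> h v" if "u \<in> carrier R" "v \<in> carrier R" for u v
  proof -
    have "h u = h (u - v) \<oplus>\<^bsub>G\<^esub> h v"
      using h_add[of "u - v" v] that R_diff_closed by simp
    then show ?thesis
      using that h_closed R_diff_closed by (simp add: G.minus_eq G.a_assoc G.r_neg)
  qed
  have h_zero: "h 0 = \<zero>\<^bsub>G\<^esub>"
    using h_diff[of 0 0] h_closed[of 0] by (simp add: G.minus_eq G.r_neg)
  have h_T: "h u = \<zero>\<^bsub>G\<^esub>" if "u \<in> T" for u
    using that
  proof (induction u rule: tensor_ideal_induct)
    case (relation r)
    have *: "x \<oplus>\<^bsub>G\<^esub> y \<ominus>\<^bsub>G\<^esub> x \<ominus>\<^bsub>G\<^esub> y = \<zero>\<^bsub>G\<^esub>" if "x \<in> carrier G" "y \<in> carrier G" for x y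
      using that by (simp add: G.a_comm[of x y] G.minus_eq G.a_assoc G.r_neg)
    from relation show ?case
    proof (cases rule: tensor_relations_cases)
      case (left l l' a)
      then show ?thesis
        using *[of "g l a" "g l' a"] h(2) closed by (simp add: h_diff R_diff_closed assms(3))
    next
      case (right l a a')
      then show ?thesis
        using *[of "g l a" "g l a'"] h(2) closed by (simp add: h_diff R_diff_closed assms(4))
    next
      case (bal l c a)
      then show ?thesis
        using h(2) closed by (simp add: h_diff assms(5) G.minus_eq G.r_neg)
    qed
  qed (auto simp: h_zero h_diff G.minus_eq)
  have h_cls: "h u = h v" if "u \<in> carrier R" "v \<in> carrier R" "cls u = cls v" for u v
    using h_T[of "u - v"] cls_eq_iff[OF that(1,2)] h_add[of "u - v" v] that h_closed R_diff_closed
    by simp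
  \<comment> \<open>The choice of representative is harmless by \<open>h_cls\<close>.\<close>
  define F where "F x = h (SOME u. u \<in> carrier R \<and> cls u = x)" for x
  have F: "F (cls u) = h u" if "u \<in> carrier R" for u
  proof -
    have "(SOME v. v \<in> carrier R \<and> cls v = cls u) \<in> carrier R \<and>
        cls (SOME v. v \<in> carrier R \<and> cls v = cls u) = cls u"
      by (rule someI[of "\<lambda>v. v \<in> carrier R \<and> cls v = cls u" u]) (use that in simp)
    then show ?thesis
      unfolding F_def using h_cls that by blast
  qed
  show thesis
  proof
    show "F x \<in> carrier G" if "x \<in> carrier LA" for x
      using that F h_closed by (auto simp: LA_carrier)
    show "F (x \<ominus>\<^bsub>LA\<^esub> y) = F x \<ominus>\<^bsub>G\<^esub> F y" if "x \<in> carrier LA" "y \<in> carrier LA" for x y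
      using that F h_diff R_diff_closed by (auto simp: LA_carrier simp flip: cls_diff)
    show "F (pt l a) = g l a" if "l \<in> carrier L" "a \<in> carrier A" for l a
      using that F h(2) by (simp add: pure_tensor_def)
  qed
qed

end

context scalar_extension
begin

lemma smult_l_distr: "c \<in> K \<Longrightarrow> c' \<in> K \<Longrightarrow> a \<in> carrier A \<Longrightarrow>
    (c \<oplus>\<^bsub>L\<^esub> c') \<odot>\<^bsub>A\<^esub> a = c \<odot>\<^bsub>A\<^esub> a \<oplus>\<^bsub>A\<^esub> c' \<odot>\<^bsub>A\<^esub> a"
  using module.smult_l_distr[OF algebra.axioms(1)[OF alg]] by simp

lemma smult_r_distr: "c \<in> K \<Longrightarrow> a \<in> carrier A \<Longrightarrow> a' \<in> carrier A \<Longrightarrow>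
    c \<odot>\<^bsub>A\<^esub> (a \<oplus>\<^bsub>A\<^esub> a') = c \<odot>\<^bsub>A\<^esub> a \<oplus>\<^bsub>A\<^esub> c \<odot>\<^bsub>A\<^esub> a'"
  using module.smult_r_distr[OF algebra.axioms(1)[OF alg]] by simp

lemma smult_assoc: "c \<in> K \<Longrightarrow> c' \<in> K \<Longrightarrow> a \<in> carrier A \<Longrightarrow>
    (c \<otimes>\<^bsub>L\<^esub> c') \<odot>\<^bsub>A\<^esub> a = c \<odot>\<^bsub>A\<^esub> (c' \<odot>\<^bsub>A\<^esub> a)"
  using module.smult_assoc1[OF algebra.axioms(1)[OF alg]] by simp

lemma smult_one: "a \<in> carrier A \<Longrightarrow> \<one>\<^bsub>L\<^esub> \<odot>\<^bsub>A\<^esub> a = a"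
  using module.smult_one[OF algebra.axioms(1)[OF alg]] by simp

text \<open>The union over representatives is compared with the map \<open>F\<close> from the
  universal property: every representative yields the class \<open>F x\<close>.\<close>

lemma id_tensor:
  assumes closed: "\<And>a. a \<in> carrier A \<Longrightarrow> f a \<in> carrier A"
    and add: "\<And>a b. a \<in> carrier A \<Longrightarrow> b \<in> carrier A \<Longrightarrow> f (a \<oplus>\<^bsub>A\<^esub> b) = f a \<oplus>\<^bsub>A\<^esub> f b"
    and smult: "\<And>c a. c \<in> K \<Longrightarrow> a \<in> carrier A \<Longrightarrow> f (c \<odot>\<^bsub>A\<^esub> a) = c \<odot>\<^bsub>A\<^esub> f a"
  shows "x \<in> carrier LA \<Longrightarrow> id_tensor L K A f x \<in> carrier LA"
    and "x \<in> carrier LA \<Longrightarrow> y \<in> carrier LA \<Longrightarrow>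
      id_tensor L K A f (x \<ominus>\<^bsub>LA\<^esub> y) = id_tensor L K A f x \<ominus>\<^bsub>LA\<^esub> id_tensor L K A f y"
    and "l \<in> carrier L \<Longrightarrow> a \<in> carrier A \<Longrightarrow> id_tensor L K A f (pt l a) = pt l (f a)"
proof -
  have bal: "pt (l \<otimes>\<^bsub>L\<^esub> c) (f a) = pt l (f (c \<odot>\<^bsub>A\<^esub> a))"
    if "l \<in> carrier L" "c \<in> K" "a \<in> carrier A" for l c a
  proof -
    have "frag_of (l \<otimes>\<^bsub>L\<^esub> c, f a) - frag_of (l, c \<odot>\<^bsub>A\<^esub> f a) \<in> tensor_relations L K A"
      unfolding tensor_relations_def using that closed by blast
    then show ?thesis
      unfolding pure_tensor_def using that closed smult by (simp add: cls_eq_iff relation_in_T)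
  qed
  obtain F where F: "\<And>x. x \<in> carrier LA \<Longrightarrow> F x \<in> carrier LA"
    "\<And>x y. x \<in> carrier LA \<Longrightarrow> y \<in> carrier LA \<Longrightarrow> F (x \<ominus>\<^bsub>LA\<^esub> y) = F x \<ominus>\<^bsub>LA\<^esub> F y"
    "\<And>l a. l \<in> carrier L \<Longrightarrow> a \<in> carrier A \<Longrightarrow> F (pt l a) = pt l (f a)"
    using closed add bal
    by (rule_tac universal_property[of LA "\<lambda>l a. pt l (f a)"])
      (auto simp: pt_add_left pt_add_right LA.abelian_group_axioms)
  define f' :: "('l \<times> 'a \<Rightarrow>\<^sub>0 int) \<Rightarrow> ('l \<times> 'a \<Rightarrow>\<^sub>0 int)" where "f' = frag_extend (\<lambda>(l, a). frag_of (l, f a))"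
  have F_zero: "F \<zero>\<^bsub>LA\<^esub> = \<zero>\<^bsub>LA\<^esub>"
    using F(2)[of "\<zero>\<^bsub>LA\<^esub>" "\<zero>\<^bsub>LA\<^esub>"] F(1)[of "\<zero>\<^bsub>LA\<^esub>"] by (simp add: LA.minus_eq LA.r_neg)
  have F_cls: "f' u \<in> carrier R \<and> F (cls u) = cls (f' u)" if "u \<in> carrier R" for u
    using that
  proof (induction u rule: R_induct)
    case zero
    then show ?case by (simp add: f'_def cls_0 F_zero)
  next
    case (single l a)
    then show ?case
      using F(3)[of l a] closed by (simp add: f'_def pure_tensor_def)
  next
    case (diff u v)
    then show ?case
      using F(2)[of "cls u" "cls v"] R_diff_closed[of "f' u" "f' v"]
      by (simp add: cls_diff) (simp add: f'_def frag_extend_diff cls_diff)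
  qed
  \<comment> \<open>All members of the union equal \<open>F x\<close>, and there is at least one
    since the class \<open>x\<close> contains \<open>u\<close>.\<close>
  have id_F: "id_tensor L K A f x = F x" if x: "x \<in> carrier LA" for x
  proof -
    obtain u where u: "u \<in> carrier R" "x = cls u"
      using x by (auto simp: LA_carrier)
    have "cls (f' v) = F x" if "v \<in> x" for v
    proof -
      have "v \<in> carrier R"
        using that u T.a_elemrcos_carrier by blast
      moreover have "cls v = cls u"
        using that u T.a_repr_independence' by blast
      ultimately show ?thesis
        using F_cls[of v] F_cls[of u] u by simp
    qed
    moreover have "u \<in> x"
      using u T.a_rcos_self by simp
    ultimately show ?thesis
      unfolding id_tensor_def f'_def by blast
  qed
  show "x \<in> carrier LA \<Longrightarrow> id_tensor L K A f x \<in> carrier LA"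
    using F id_F by simp
  show "x \<in> carrier LA \<Longrightarrow> y \<in> carrier LA \<Longrightarrow>
      id_tensor L K A f (x \<ominus>\<^bsub>LA\<^esub> y) = id_tensor L K A f x \<ominus>\<^bsub>LA\<^esub> id_tensor L K A f y"
    using F id_F by simp
  show "l \<in> carrier L \<Longrightarrow> a \<in> carrier A \<Longrightarrow> id_tensor L K A f (pt l a) = pt l (f a)"
    using F id_F by simp
qed

end

lemma (in ring) add_pow_minus:
  assumes "x \<in> carrier R" "y \<in> carrier R"
  shows "add_pow R (n::nat) (x \<ominus> y) = add_pow R n x \<ominus> add_pow R n y"
proof -
  have eq: "add_pow R n z = z \<otimes> add_pow R n \<one>" if "z \<in> carrier R" for z
    using that by (simp add: add_pow_rdistr)
  have "(x \<ominus> y) \<otimes> add_pow R n \<one> = x \<otimes> add_pow R n \<one> \<ominus> y \<otimes> add_pow R n \<one>"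
    using assms by (simp add: minus_eq l_distr l_minus)
  then show ?thesis
    using assms eq[of x] eq[of y] eq[of "x \<ominus> y"] by simp
qed

section \<open>Base change of an exponential map\<close>

text \<open>\<phi> is the projection onto \<open>K\<close> along a complementary subspace. It
  supplies the map from the base change back to \<open>A\<close>.\<close>

lemma (in field) subfield_retraction:
  assumes "subfield K R"
  obtains \<phi> where "\<And>x. x \<in> carrier R \<Longrightarrow> \<phi> x \<in> K"
    and "\<And>x y. x \<in> carrier R \<Longrightarrow> y \<in> carrier R \<Longrightarrow> \<phi> (x \<oplus> y) = \<phi> x \<oplus> \<phi> y"
    and "\<And>x c. x \<in> carrier R \<Longrightarrow> c \<in> K \<Longrightarrow> \<phi> (x \<otimes> c) = \<phi> x \<otimes> c"
    and "\<phi> \<one> = \<one>"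
proof -
  interpret K: subfield K R by fact
  have K_closed [simp]: "c \<in> carrier R" if "c \<in> K" for c
    using subringE(1)[OF K.subring_axioms] that by auto
  note K_ring = subringE(2-7)[OF K.subring_axioms]
  have K_minus: "a \<ominus> b \<in> K" if "a \<in> K" "b \<in> K" for a b
    using that K_ring by (simp add: minus_eq)
  have K_inv: "inv c \<in> K \<and> c \<otimes> inv c = \<one>" if "c \<in> K" "c \<noteq> \<zero>" for c
    using subfield_m_inv[OF assms, of c] that by auto
  \<comment> \<open>A maximal \<open>K\<close>-subspace avoiding \<open>\<one>\<close> is a complement of \<open>K\<close>.\<close>
  define \<A> where "\<A> = {W. W \<subseteq> carrier R \<and> \<zero> \<in> W \<and> (\<forall>v\<in>W. \<forall>w\<in>W. v \<ominus> w \<in> W) \<and>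
      (\<forall>w\<in>W. \<forall>c\<in>K. w \<otimes> c \<in> W) \<and> \<one> \<notin> W}"
  have "\<exists>M\<in>\<A>. \<forall>W\<in>\<A>. M \<subseteq> W \<longrightarrow> W = M"
  proof (rule subset_Zorn_nonempty)
    have "{\<zero>} \<in> \<A>"
      by (simp add: \<A>_def minus_eq)
    then show "\<A> \<noteq> {}" by blast
    fix \<C> assume \<C>: "\<C> \<noteq> {}" "subset.chain \<A> \<C>"
    then have sub: "W \<in> \<A>" if "W \<in> \<C>" for W
      using that by (auto simp: subset.chain_def)
    have "v \<ominus> w \<in> \<Union>\<C>" if vw: "v \<in> \<Union>\<C>" "w \<in> \<Union>\<C>" for v w
    proof -
      obtain V W where VW: "V \<in> \<C>" "v \<in> V" "W \<in> \<C>" "w \<in> W"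
        using vw by auto
      then have "V \<subseteq> W \<or> W \<subseteq> V"
        using \<C>(2) by (auto simp: subset_chain_def)
      then obtain U where "U \<in> \<C>" "v \<in> U" "w \<in> U"
        using VW by auto
      then show ?thesis
        using sub[of U] by (auto simp: \<A>_def)
    qed
    moreover have "\<Union>\<C> \<subseteq> carrier R" "\<zero> \<in> \<Union>\<C>" "\<one> \<notin> \<Union>\<C>" "\<And>w c. w \<in> \<Union>\<C> \<Longrightarrow> c \<in> K \<Longrightarrow> w \<otimes> c \<in> \<Union>\<C>"
      using sub \<C>(1) by (fastforce simp: \<A>_def)+
    ultimately show "\<Union>\<C> \<in> \<A>"
      unfolding \<A>_def by blast
  qed
  then obtain M where M: "M \<in> \<A>" "\<And>W. W \<in> \<A> \<Longrightarrow> M \<subseteq> W \<Longrightarrow> W = M"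
    by blast
  have M_sub: "w \<in> carrier R" if "w \<in> M" for w
    using M(1) that by (auto simp: \<A>_def)
  have M_zero: "\<zero> \<in> M" and M_one: "\<one> \<notin> M"
    and M_minus: "\<And>v w. v \<in> M \<Longrightarrow> w \<in> M \<Longrightarrow> v \<ominus> w \<in> M"
    and M_mult: "\<And>w c. w \<in> M \<Longrightarrow> c \<in> K \<Longrightarrow> w \<otimes> c \<in> M"
    using M(1) by (auto simp: \<A>_def)
  have ex: "\<exists>k\<in>K. x \<ominus> k \<in> M" if x: "x \<in> carrier R" for x
  proof (rule ccontr)
    assume no: "\<not> ?thesis"
    \<comment> \<open>\<open>W\<close> is the span of \<open>M\<close> and \<open>x\<close>. It
      properly contains \<open>M\<close>, so by maximality it must contain \<one>; solving the
      resulting equation for \<open>x\<close> contradicts \<open>no\<close>.\<close>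
    define W where "W = {w \<oplus> x \<otimes> k | w k. w \<in> M \<and> k \<in> K}"
    have "M \<subseteq> W"
    proof
      fix w assume "w \<in> M"
      then have "w = w \<oplus> x \<otimes> \<zero>"
        using x M_sub by simp
      then show "w \<in> W"
        using \<open>w \<in> M\<close> K_ring(1) unfolding W_def by blast
    qed
    have "x = \<zero> \<oplus> x \<otimes> \<one>"
      using x by simp
    then have "x \<in> W"
      using M_zero K_ring(2) unfolding W_def by blast
    moreover have "x \<notin> M"
    proof
      assume "x \<in> M"
      then have "x \<ominus> \<zero> \<in> M"
        using M_minus M_zero by blast
      then show False
        using no K_ring(1) by blast
    qed
    ultimately have "W \<notin> \<A>"
      using M(2) \<open>M \<subseteq> W\<close> by blast
    moreover have "W \<subseteq> carrier R"
      using x M_sub by (auto simp: W_def)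
    moreover have "\<zero> \<in> W"
      using \<open>M \<subseteq> W\<close> M_zero by blast
    moreover have "u \<ominus> v \<in> W" if uv: "u \<in> W" "v \<in> W" for u v
    proof -
      obtain a k b j where abk: "u = a \<oplus> x \<otimes> k" "v = b \<oplus> x \<otimes> j" "a \<in> M" "b \<in> M" "k \<in> K" "j \<in> K"
        using uv by (auto simp: W_def)
      then have "a \<in> carrier R" "b \<in> carrier R" "k \<in> carrier R" "j \<in> carrier R"
        using M_sub by auto
      then have "u \<ominus> v = (a \<ominus> b) \<oplus> x \<otimes> (k \<ominus> j)"
        unfolding abk using x by algebra
      then show ?thesis
        using abk M_minus K_minus unfolding W_def by blast
    qed
    moreover have "u \<otimes> c \<in> W" if uc: "u \<in> W" "c \<in> K" for u c
    proof -
      obtain a k where ak: "u = a \<oplus> x \<otimes> k" "a \<in> M" "k \<in> K"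
        using uc by (auto simp: W_def)
      then have "a \<in> carrier R" "k \<in> carrier R" "c \<in> carrier R"
        using M_sub uc by auto
      then have "u \<otimes> c = a \<otimes> c \<oplus> x \<otimes> (k \<otimes> c)"
        unfolding ak using x by algebra
      then show ?thesis
        using ak M_mult K_ring(5) uc unfolding W_def by blast
    qed
    ultimately have "\<one> \<in> W"
      by (auto simp: \<A>_def)
    then obtain w k where wk: "\<one> = w \<oplus> x \<otimes> k" "w \<in> M" "k \<in> K"
      by (auto simp: W_def)
    \<comment> \<open>Otherwise \<one> would be \<open>w\<close>, an element of
      \<open>M\<close>.\<close>
    have "k \<noteq> \<zero>"
      using wk x M_sub M_one by auto
    then have k: "inv k \<in> K" "k \<otimes> inv k = \<one>"
      using K_inv wk by auto
    have "x \<ominus> inv k = (\<zero> \<ominus> w) \<otimes> inv k"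
    proof -
      have car: "k \<in> carrier R" "inv k \<in> carrier R" "w \<in> carrier R"
        using wk k M_sub by auto
      have "(\<zero> \<ominus> w) \<otimes> inv k = x \<otimes> (k \<otimes> inv k) \<ominus> (w \<oplus> x \<otimes> k) \<otimes> inv k"
        using car x by algebra
      also have "\<dots> = x \<ominus> inv k"
        using car x k(2) by (simp flip: wk(1))
      finally show ?thesis by simp
    qed
    then have "x \<ominus> inv k \<in> M"
      using M_mult M_minus M_zero wk k by metis
    then show False
      using no k by blast
  qed
  \<comment> \<open>A nonzero element of both \<open>M\<close> and \<open>K\<close>, scaled by its
    inverse, would put \<one> into \<open>M\<close>.\<close>
  have uniq: "k = j" if "k \<in> K" "j \<in> K" "x \<ominus> k \<in> M" "x \<ominus> j \<in> M" "x \<in> carrier R" for x k j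
  proof (rule ccontr)
    assume "k \<noteq> j"
    then have "j \<ominus> k \<noteq> \<zero>"
      using that by auto
    then have i: "inv (j \<ominus> k) \<in> K" "(j \<ominus> k) \<otimes> inv (j \<ominus> k) = \<one>"
      using K_inv[OF K_minus[OF that(2,1)]] by auto
    have "j \<ominus> k = (x \<ominus> k) \<ominus> (x \<ominus> j)"
      using that(5) K_closed[OF that(1)] K_closed[OF that(2)] by algebra
    then have "j \<ominus> k \<in> M"
      using M_minus that by simp
    then show False
      using M_mult[OF _ i(1)] i(2) M_one by metis
  qed
  define \<phi> where "\<phi> x = (SOME k. k \<in> K \<and> x \<ominus> k \<in> M)" for x
  have \<phi>: "\<phi> x \<in> K \<and> x \<ominus> \<phi> x \<in> M" if "x \<in> carrier R" for x
    unfolding \<phi>_def by (rule someI_ex) (use ex[OF that] in blast)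
  have \<phi>_eq: "\<phi> x = k" if "x \<in> carrier R" "k \<in> K" "x \<ominus> k \<in> M" for x k
    using uniq \<phi> that by blast
  show thesis
  proof
    show "\<phi> x \<in> K" if "x \<in> carrier R" for x
      using \<phi> that by blast
    show "\<phi> (x \<oplus> y) = \<phi> x \<oplus> \<phi> y" if xy: "x \<in> carrier R" "y \<in> carrier R" for x y
    proof (rule \<phi>_eq)
      \<comment> \<open>Sums are written as differences since \<open>M\<close> is given as closed
        under subtraction.\<close>
      have "x \<oplus> y \<ominus> (\<phi> x \<oplus> \<phi> y) = (x \<ominus> \<phi> x) \<ominus> (\<zero> \<ominus> (y \<ominus> \<phi> y))"
        using xy K_closed[of "\<phi> x"] K_closed[of "\<phi> y"] \<phi>[of x] \<phi>[of y] by algebra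
      then show "x \<oplus> y \<ominus> (\<phi> x \<oplus> \<phi> y) \<in> M"
        using \<phi>[of x] \<phi>[of y] xy M_minus M_zero by simp
    qed (use xy \<phi>[of x] \<phi>[of y] K_ring(6) in simp_all)
    show "\<phi> (x \<otimes> c) = \<phi> x \<otimes> c" if xc: "x \<in> carrier R" "c \<in> K" for x c
    proof (rule \<phi>_eq)
      have "x \<otimes> c \<ominus> \<phi> x \<otimes> c = (x \<ominus> \<phi> x) \<otimes> c"
        using xc K_closed[of "\<phi> x"] K_closed[of c] \<phi>[of x] by algebra
      then show "x \<otimes> c \<ominus> \<phi> x \<otimes> c \<in> M"
        using \<phi> xc M_mult by simp
    qed (use xc \<phi>[of x] K_ring(5) in simp_all)
    show "\<phi> \<one> = \<one>"
      using M_zero K_ring(2) by (intro \<phi>_eq) (auto simp: minus_eq r_neg)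
  qed
qed

section \<open>The extended exponential map and the retraction\<close>

locale scalar_extension_exp = scalar_extension + S: exp_map A \<sigma> for \<sigma> +
  assumes over: "\<And>c. c \<in> K \<Longrightarrow> c \<odot>\<^bsub>A\<^esub> \<one>\<^bsub>A\<^esub> \<in> exp_invariants A \<sigma>"
begin

abbreviation "\<sigma>' \<equiv> base_change_map L K A \<sigma>"

text \<open>Scaling by \<open>c\<close> is multiplication by the invariant
  \<open>c \<odot> \<one>\<close>. This is the linearity that \<open>id_tensor\<close> requires of
  each coefficient map.\<close>

lemma sigma_smult: "c \<in> K \<Longrightarrow> a \<in> carrier A \<Longrightarrow> \<sigma> (c \<odot>\<^bsub>A\<^esub> a) i = c \<odot>\<^bsub>A\<^esub> \<sigma> a i"
  using S.tau_invariant_mult[OF over, of c a i] by (simp add: smult_mult)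

lemma sigma':
  shows sigma'_closed: "x \<in> carrier LA \<Longrightarrow> \<sigma>' x i \<in> carrier LA"
    and sigma'_minus: "x \<in> carrier LA \<Longrightarrow> y \<in> carrier LA \<Longrightarrow> \<sigma>' (x \<ominus>\<^bsub>LA\<^esub> y) i = \<sigma>' x i \<ominus>\<^bsub>LA\<^esub> \<sigma>' y i"
    and sigma'_pt: "l \<in> carrier L \<Longrightarrow> a \<in> carrier A \<Longrightarrow> \<sigma>' (pt l a) i = pt l (\<sigma> a i)"
proof -
  let ?f = "\<lambda>a. up_ring.coeff (UP A) (\<sigma> a) i"
  have f: "\<And>a. a \<in> carrier A \<Longrightarrow> ?f a = \<sigma> a i"
    by (rule S.coeff_tau)
  note id = id_tensor[of ?f]
  show "x \<in> carrier LA \<Longrightarrow> \<sigma>' x i \<in> carrier LA"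
    unfolding base_change_map_def by (rule id(1)) (auto simp: f S.tau_add sigma_smult)
  show "x \<in> carrier LA \<Longrightarrow> y \<in> carrier LA \<Longrightarrow> \<sigma>' (x \<ominus>\<^bsub>LA\<^esub> y) i = \<sigma>' x i \<ominus>\<^bsub>LA\<^esub> \<sigma>' y i"
    unfolding base_change_map_def by (rule id(2)) (auto simp: f S.tau_add sigma_smult)
  show "\<sigma>' (pt l a) i = pt l (\<sigma> a i)" if "l \<in> carrier L" "a \<in> carrier A"
    unfolding base_change_map_def f[OF that(2), symmetric]
    by (rule id(3)) (use that in \<open>auto simp: f S.tau_add sigma_smult\<close>)
qed

lemma sigma'_zero: "\<sigma>' \<zero>\<^bsub>LA\<^esub> i = \<zero>\<^bsub>LA\<^esub>"
  using sigma'_minus[of "\<zero>\<^bsub>LA\<^esub>" "\<zero>\<^bsub>LA\<^esub>" i] sigma'_closed[of "\<zero>\<^bsub>LA\<^esub>" i]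
  by (simp add: LA.minus_eq LA.r_neg)

text \<open>Coefficients are defined one index at a time, so a common bound has to be found: pure
  tensors inherit that of \<sigma>, and a difference takes the larger of two bounds.\<close>

lemma sigma'_UP: "x \<in> carrier LA \<Longrightarrow> \<sigma>' x \<in> carrier (UP LA)"
proof -
  assume x: "x \<in> carrier LA"
  then have "\<exists>n. \<forall>i>n. \<sigma>' x i = \<zero>\<^bsub>LA\<^esub>"
  proof (induction x rule: LA_induct)
    case (pure l a)
    then show ?case
      using S.tau_above_deg[of a] by (intro exI[of _ "exp_deg A \<sigma> a"]) (auto simp: sigma'_pt pt_zero_right)
  next
    case (diff x y)
    then obtain m n where "\<forall>i>m. \<sigma>' x i = \<zero>\<^bsub>LA\<^esub>" "\<forall>i>n. \<sigma>' y i = \<zero>\<^bsub>LA\<^esub>"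
      by blast
    then show ?case
      using diff(1,2) by (intro exI[of _ "max m n"]) (simp add: sigma'_minus)
  qed (auto simp: sigma'_zero)
  then have "\<exists>n. bound \<zero>\<^bsub>LA\<^esub> n (\<sigma>' x)"
    by (auto simp: bound_def)
  then show ?thesis
    using sigma'_closed[OF x] by (auto simp: UP_def intro!: mem_upI)
qed

sublocale U: UP_cring LA "UP LA"
  by unfold_locales

lemma coeff_sigma': "x \<in> carrier LA \<Longrightarrow> up_ring.coeff (UP LA) (\<sigma>' x) i = \<sigma>' x i"
  by (rule UP_coeff_apply[OF sigma'_UP])

lemma sigma'_minus_UP:
  assumes "x \<in> carrier LA" "y \<in> carrier LA"
  shows "\<sigma>' (x \<ominus>\<^bsub>LA\<^esub> y) = \<sigma>' x \<ominus>\<^bsub>UP LA\<^esub> \<sigma>' y"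
  using assms by (intro U.up_eqI) (auto simp: coeff_sigma' sigma'_UP sigma'_minus U.P.minus_closed)

text \<open>Biadditivity reduces both arguments to pure tensors, where the claim is the convolution
  formula for \<sigma>.\<close>

lemma sigma'_mult:
  assumes "x \<in> carrier LA" "y \<in> carrier LA"
  shows "\<sigma>' (x \<otimes>\<^bsub>LA\<^esub> y) = \<sigma>' x \<otimes>\<^bsub>UP LA\<^esub> \<sigma>' y"
proof -
  have zero_UP: "\<sigma>' \<zero>\<^bsub>LA\<^esub> = \<zero>\<^bsub>UP LA\<^esub>"
    by (intro U.up_eqI) (auto simp: coeff_sigma' sigma'_UP sigma'_zero)
  show ?thesis
    using assms(1)
  proof (induction x rule: LA_induct)
    case zero
    then show ?case
      using assms(2) by (simp add: zero_UP sigma'_UP)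
  next
    case x: (pure l a)
    show ?case
      using assms(2)
    proof (induction y rule: LA_induct)
      case zero
      then show ?case
        using x by (simp add: zero_UP sigma'_UP)
    next
      case y: (pure l' a')
      have *: "\<sigma>' (pt l a \<otimes>\<^bsub>LA\<^esub> pt l' a') n = (\<Oplus>\<^bsub>LA\<^esub>i\<in>{..n}. \<sigma>' (pt l a) i \<otimes>\<^bsub>LA\<^esub> \<sigma>' (pt l' a') (n - i))" for n
        using x y by (simp add: pt_mult sigma'_pt S.tau_mult pt_finsum)
      show ?case
      proof (rule U.up_eqI)
        fix n
        show "up_ring.coeff (UP LA) (\<sigma>' (pt l a \<otimes>\<^bsub>LA\<^esub> pt l' a')) n =
            up_ring.coeff (UP LA) (\<sigma>' (pt l a) \<otimes>\<^bsub>UP LA\<^esub> \<sigma>' (pt l' a')) n"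
          using x y *[of n] by (simp add: coeff_sigma' sigma'_UP)
      qed (use x y in \<open>simp_all add: sigma'_UP\<close>)
    next
      case (diff y z)
      have "pt l a \<otimes>\<^bsub>LA\<^esub> (y \<ominus>\<^bsub>LA\<^esub> z) = pt l a \<otimes>\<^bsub>LA\<^esub> y \<ominus>\<^bsub>LA\<^esub> pt l a \<otimes>\<^bsub>LA\<^esub> z"
        using diff(1,2) x by (simp add: LA.minus_eq LA.r_distr LA.r_minus)
      then show ?case
        using diff x by (simp add: sigma'_minus_UP U.P.minus_eq U.P.r_distr U.P.r_minus sigma'_UP)
    qed
  next
    case (diff x z)
    have "(x \<ominus>\<^bsub>LA\<^esub> z) \<otimes>\<^bsub>LA\<^esub> y = x \<otimes>\<^bsub>LA\<^esub> y \<ominus>\<^bsub>LA\<^esub> z \<otimes>\<^bsub>LA\<^esub> y"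
      using diff(1,2) assms(2) by (simp add: LA.minus_eq LA.l_distr LA.l_minus)
    then show ?case
      using diff assms(2) by (simp add: sigma'_minus_UP U.P.minus_eq U.P.l_distr U.P.l_minus sigma'_UP)
  qed
qed

text \<open>In coefficient form both exponential axioms are additive identities, so they pass from
  pure tensors to all elements.\<close>

lemma base_change_exp_map: "exp_map LA \<sigma>'"
proof
  show "\<sigma>' \<in> ring_hom LA (UP LA)"
  proof (rule ring_hom_memI)
    show "\<sigma>' \<one>\<^bsub>LA\<^esub> = \<one>\<^bsub>UP LA\<^esub>"
      using sigma'_pt[of "\<one>\<^bsub>L\<^esub>" "\<one>\<^bsub>A\<^esub>"]
      by (intro U.up_eqI) (simp_all add: coeff_sigma' sigma'_UP S.tau_one pt_one pt_zero_right)
    fix x y assume xy: "x \<in> carrier LA" "y \<in> carrier LA"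
    then show "\<sigma>' (x \<otimes>\<^bsub>LA\<^esub> y) = \<sigma>' x \<otimes>\<^bsub>UP LA\<^esub> \<sigma>' y"
      by (rule sigma'_mult)
    have "\<sigma>' (x \<oplus>\<^bsub>LA\<^esub> y) = \<sigma>' (x \<ominus>\<^bsub>LA\<^esub> (\<zero>\<^bsub>LA\<^esub> \<ominus>\<^bsub>LA\<^esub> y))"
      using xy by (simp add: LA.minus_eq)
    also have "\<dots> = \<sigma>' x \<oplus>\<^bsub>UP LA\<^esub> \<sigma>' y"
      using xy by (intro U.up_eqI)
        (simp_all add: coeff_sigma' sigma'_UP sigma'_minus sigma'_zero sigma'_closed, simp add: LA.minus_eq sigma'_closed)
    finally show "\<sigma>' (x \<oplus>\<^bsub>LA\<^esub> y) = \<sigma>' x \<oplus>\<^bsub>UP LA\<^esub> \<sigma>' y" .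
  qed (rule sigma'_UP)
  show "\<sigma>' x 0 = x" if "x \<in> carrier LA" for x
    using that
    by (induction x rule: LA_induct) (auto simp: sigma'_zero sigma'_minus sigma'_pt S.tau_0)
  show "\<sigma>' (\<sigma>' x i) j = add_pow LA ((i + j) choose i) (\<sigma>' x (i + j))" if "x \<in> carrier LA" for x i j
    using that
    by (induction x rule: LA_induct)
      (auto simp: sigma'_zero sigma'_minus sigma'_pt sigma'_closed S.tau_tau pt_add_pow LA.add_pow_minus)
qed

sublocale LA: exp_map LA \<sigma>'
  by (rule base_change_exp_map)

text \<open>The map induced by sending \<open>pt l a\<close> to \<open>\<phi> l \<odot> a\<close>.
  Since it commutes with the exponential maps, it takes invariants to invariants.\<close>

lemma retraction:
  obtains \<Phi> where "\<And>x. x \<in> carrier LA \<Longrightarrow> \<Phi> x \<in> carrier A"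
    and "\<And>x y. x \<in> carrier LA \<Longrightarrow> y \<in> carrier LA \<Longrightarrow> \<Phi> (x \<oplus>\<^bsub>LA\<^esub> y) = \<Phi> x \<oplus>\<^bsub>A\<^esub> \<Phi> y"
    and "\<And>x a. x \<in> carrier LA \<Longrightarrow> a \<in> carrier A \<Longrightarrow> \<Phi> (x \<otimes>\<^bsub>LA\<^esub> pt \<one>\<^bsub>L\<^esub> a) = \<Phi> x \<otimes>\<^bsub>A\<^esub> a"
    and "\<And>a. a \<in> carrier A \<Longrightarrow> \<Phi> (pt \<one>\<^bsub>L\<^esub> a) = a"
    and "\<And>x i. x \<in> carrier LA \<Longrightarrow> \<Phi> (\<sigma>' x i) = \<sigma> (\<Phi> x) i"
proof -
  obtain \<phi> where \<phi>: "\<And>x. x \<in> carrier L \<Longrightarrow> \<phi> x \<in> K"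
    "\<And>x y. x \<in> carrier L \<Longrightarrow> y \<in> carrier L \<Longrightarrow> \<phi> (x \<oplus>\<^bsub>L\<^esub> y) = \<phi> x \<oplus>\<^bsub>L\<^esub> \<phi> y"
    "\<And>x c. x \<in> carrier L \<Longrightarrow> c \<in> K \<Longrightarrow> \<phi> (x \<otimes>\<^bsub>L\<^esub> c) = \<phi> x \<otimes>\<^bsub>L\<^esub> c"
    "\<phi> \<one>\<^bsub>L\<^esub> = \<one>\<^bsub>L\<^esub>"
    using L.subfield_retraction[OF K.subfield_axioms] by metis
  obtain \<Phi> where \<Phi>: "\<And>x. x \<in> carrier LA \<Longrightarrow> \<Phi> x \<in> carrier A"
    "\<And>x y. x \<in> carrier LA \<Longrightarrow> y \<in> carrier LA \<Longrightarrow> \<Phi> (x \<ominus>\<^bsub>LA\<^esub> y) = \<Phi> x \<ominus>\<^bsub>A\<^esub> \<Phi> y"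
    "\<And>l a. l \<in> carrier L \<Longrightarrow> a \<in> carrier A \<Longrightarrow> \<Phi> (pt l a) = \<phi> l \<odot>\<^bsub>A\<^esub> a"
    by (rule universal_property[of A "\<lambda>l a. \<phi> l \<odot>\<^bsub>A\<^esub> a"])
      (auto simp: \<phi> smult_l_distr smult_r_distr smult_assoc A.abelian_group_axioms)
  have zero: "\<Phi> \<zero>\<^bsub>LA\<^esub> = \<zero>\<^bsub>A\<^esub>"
    using \<Phi>(1)[of "\<zero>\<^bsub>LA\<^esub>"] \<Phi>(2)[of "\<zero>\<^bsub>LA\<^esub>" "\<zero>\<^bsub>LA\<^esub>"]
    by (simp add: LA.minus_eq A.minus_eq A.r_neg)
  show thesis
  proof
    show "\<Phi> x \<in> carrier A" if "x \<in> carrier LA" for x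
      using that by (rule \<Phi>(1))
    show "\<Phi> (x \<oplus>\<^bsub>LA\<^esub> y) = \<Phi> x \<oplus>\<^bsub>A\<^esub> \<Phi> y" if xy: "x \<in> carrier LA" "y \<in> carrier LA" for x y
    proof -
      have "\<Phi> (x \<oplus>\<^bsub>LA\<^esub> y) = \<Phi> (x \<ominus>\<^bsub>LA\<^esub> (\<zero>\<^bsub>LA\<^esub> \<ominus>\<^bsub>LA\<^esub> y))"
        using xy by (simp add: LA.minus_eq)
      also have "\<dots> = \<Phi> x \<oplus>\<^bsub>A\<^esub> \<Phi> y"
        using xy by (simp add: \<Phi> zero A.minus_eq)
      finally show ?thesis .
    qed
    show "\<Phi> (x \<otimes>\<^bsub>LA\<^esub> pt \<one>\<^bsub>L\<^esub> b) = \<Phi> x \<otimes>\<^bsub>A\<^esub> b" if "x \<in> carrier LA" and b: "b \<in> carrier A" for x b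
      using that(1)
    proof (induction x rule: LA_induct)
      case (diff x y)
      have "(x \<ominus>\<^bsub>LA\<^esub> y) \<otimes>\<^bsub>LA\<^esub> pt \<one>\<^bsub>L\<^esub> b = x \<otimes>\<^bsub>LA\<^esub> pt \<one>\<^bsub>L\<^esub> b \<ominus>\<^bsub>LA\<^esub> y \<otimes>\<^bsub>LA\<^esub> pt \<one>\<^bsub>L\<^esub> b"
        using diff(1,2) b by (simp add: LA.minus_eq LA.l_distr LA.l_minus)
      then show ?case
        using diff b by (simp add: \<Phi>(1,2) A.minus_eq A.l_distr A.l_minus)
    qed (use b in \<open>auto simp: zero pt_mult \<Phi>(3) smult_mult \<phi>\<close>)
    show "\<Phi> (pt \<one>\<^bsub>L\<^esub> a) = a" if "a \<in> carrier A" for a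
      using that by (simp add: \<Phi>(3) \<phi> smult_one)
    show "\<Phi> (\<sigma>' x i) = \<sigma> (\<Phi> x) i" if "x \<in> carrier LA" for x i
      using that
      by (induction x rule: LA_induct)
        (auto simp: sigma'_zero zero sigma'_pt \<Phi> \<phi> sigma_smult sigma'_minus sigma'_closed S.tau_minus)
  qed
qed

text \<open>The retraction is a left inverse of the embedding of \<open>A\<close>.\<close>

lemma pt_inj: "a \<in> carrier A \<Longrightarrow> pt \<one>\<^bsub>L\<^esub> a = \<zero>\<^bsub>LA\<^esub> \<longleftrightarrow> a = \<zero>\<^bsub>A\<^esub>"
  by (rule retraction) (metis A.zero_closed L.one_closed pt_zero_right)

lemma exp_deg_pt: "a \<in> carrier A \<Longrightarrow> exp_deg LA \<sigma>' (pt \<one>\<^bsub>L\<^esub> a) = exp_deg A \<sigma> a"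
proof (rule antisym)
  assume a: "a \<in> carrier A"
  show "exp_deg LA \<sigma>' (pt \<one>\<^bsub>L\<^esub> a) \<le> exp_deg A \<sigma> a"
    using a S.tau_above_deg by (intro LA.exp_deg_le) (auto simp: sigma'_pt pt_zero_right)
  show "exp_deg A \<sigma> a \<le> exp_deg LA \<sigma>' (pt \<one>\<^bsub>L\<^esub> a)"
  proof (rule S.exp_deg_le[OF a])
    fix i assume "i > exp_deg LA \<sigma>' (pt \<one>\<^bsub>L\<^esub> a)"
    then have "pt \<one>\<^bsub>L\<^esub> (\<sigma> a i) = \<zero>\<^bsub>LA\<^esub>"
      using LA.tau_above_deg[of "pt \<one>\<^bsub>L\<^esub> a" i] a by (simp add: sigma'_pt)
    then show "\<sigma> a i = \<zero>\<^bsub>A\<^esub>"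
      using a by (simp add: pt_inj)
  qed
qed

lemma pt_const_invariant: "l \<in> carrier L \<Longrightarrow> pt l \<one>\<^bsub>A\<^esub> \<in> exp_invariants LA \<sigma>'"
  unfolding LA.invariant_iff by (auto simp: sigma'_pt S.tau_one pt_zero_right)

end

section \<open>Descent\<close>

theorem theorem2p1:
  fixes L :: "('l, 'm) ring_scheme"
    and K :: "'l set"
    and A :: "('l, 'a, 'n) module_scheme"
    and \<sigma> :: "'a \<Rightarrow> nat \<Rightarrow> 'a"
    and Abar :: "('l \<times> 'a \<Rightarrow>\<^sub>0 int) set ring"
    and \<sigma>bar :: "('l \<times> 'a \<Rightarrow>\<^sub>0 int) set \<Rightarrow> nat \<Rightarrow> ('l \<times> 'a \<Rightarrow>\<^sub>0 int) set"
    and s :: 'a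
    and l :: nat
    and p :: "nat \<Rightarrow> ('l \<times> 'a \<Rightarrow>\<^sub>0 int) set"
  assumes "algebraic_closure L K"
    and "algebra (L\<lparr>carrier := K\<rparr>) A"
    and "exponential_map_over A \<sigma> ((\<lambda>c. c \<odot>\<^bsub>A\<^esub> \<one>\<^bsub>A\<^esub>) ` K)"
    and "nontrivial_exponential_map A \<sigma>"
    and "Abar = base_change L K A"
    and "\<sigma>bar = base_change_map L K A \<sigma>"
    and "s \<in> carrier A"
    and "minimal_local_slice Abar \<sigma>bar (pure_tensor L K A \<one>\<^bsub>L\<^esub> s)"
    and "nonzero_divisor Abar (pure_tensor L K A \<one>\<^bsub>L\<^esub> (exp_lc A \<sigma> s))"
    and "p \<in> {1..l} \<rightarrow> exp_invariants Abar \<sigma>bar"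
    and "pure_tensor L K A \<one>\<^bsub>L\<^esub> (exp_lc A \<sigma> s) = (\<Otimes>\<^bsub>Abar\<^esub>i\<in>{1..l}. p i)"
    and "\<And>i. i \<in> {1..l} \<Longrightarrow>
           (\<lambda>c. PIdl\<^bsub>invariant_ring Abar \<sigma>bar\<^esub> (p i)
                  +>\<^bsub>invariant_ring Abar \<sigma>bar\<^esub> pure_tensor L K A c \<one>\<^bsub>A\<^esub>)
             \<in> ring_iso L (invariant_ring Abar \<sigma>bar Quot PIdl\<^bsub>invariant_ring Abar \<sigma>bar\<^esub> (p i))"
    and "\<And>i. i \<in> {1..l} \<Longrightarrow> domain (Abar Quot PIdl\<^bsub>Abar\<^esub> (p i))"
  shows "is_polynomial_ring_in A (exp_invariants A \<sigma>) s"
proof -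
  interpret ac: algebraic_closure L K by fact
  have "cring A"
    using assms(2) by (simp add: algebra_def)
  interpret scalar_extension L K A
    by (intro scalar_extension.intro scalar_extension_axioms.intro ac.field_axioms
        ac.subfield_axioms \<open>cring A\<close> assms(2))
  have exp: "exponential_map A \<sigma>" and inv: "(\<lambda>c. c \<odot>\<^bsub>A\<^esub> \<one>\<^bsub>A\<^esub>) ` K \<subseteq> exp_invariants A \<sigma>"
    using assms(3) by (auto simp: exponential_map_over_def)
  interpret scalar_extension_exp L K A \<sigma>
    by (intro scalar_extension_exp.intro scalar_extension_exp_axioms.intro scalar_extension_axioms
        exponential_map_imp_exp_map \<open>cring A\<close> exp) (use inv in auto)
  note [simp] = assms(5,6)
  note s = assms(7)
  let ?s = "pt \<one>\<^bsub>L\<^esub> s"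
  let ?I = "invariant_ring LA \<sigma>'"
  define d where "d = exp_deg A \<sigma> s"
  have lc: "exp_lc A \<sigma> s = \<sigma> s d"
    using s by (simp add: S.exp_lc_eq d_def)
  have slice: "local_slice LA \<sigma>' ?s"
    using assms(8) by (simp add: minimal_local_slice_def)
  have d_LA: "exp_deg LA \<sigma>' ?s = d"
    using s by (simp add: exp_deg_pt d_def)
  have d_minimal: "d \<le> exp_deg LA \<sigma>' b" if "b \<in> carrier LA" "b \<notin> exp_invariants LA \<sigma>'" for b
    using slice that by (auto simp: local_slice_def d_LA)
  \<comment> \<open>The slice shares its degree with a non-invariant element.\<close>
  have "d > 0"
    using slice LA.exp_deg_0_iff by (auto simp: local_slice_def d_LA)
  have nzd: "nonzero_divisor LA (\<sigma>' ?s d)"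
    using assms(9) s by (simp add: sigma'_pt lc)
  interpret B: exp_slice LA \<sigma>' ?s d
    by unfold_locales
      (use s \<open>d > 0\<close> d_minimal nzd LA.tau_above_deg[of ?s] d_LA in auto)
  \<comment> \<open>Minimality of \<open>d\<close> and cancellation of the leading coefficient
    descend to \<open>A\<close>, because the embedding is injective, preserves degrees and keeps
    non-invariant elements non-invariant.\<close>
  interpret A: exp_slice A \<sigma> s d
  proof
    show "\<sigma> s i = \<zero>\<^bsub>A\<^esub>" if "i > d" for i
      using that s S.tau_above_deg by (simp add: d_def)
    show "d \<le> exp_deg A \<sigma> b" if b: "b \<in> carrier A" "b \<notin> exp_invariants A \<sigma>" for b
    proof -
      have "exp_deg LA \<sigma>' (pt \<one>\<^bsub>L\<^esub> b) \<noteq> 0"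
        using b by (simp add: exp_deg_pt S.exp_deg_0_iff)
      then have "pt \<one>\<^bsub>L\<^esub> b \<notin> exp_invariants LA \<sigma>'"
        using b LA.exp_deg_0_iff[of "pt \<one>\<^bsub>L\<^esub> b"] by simp
      then show ?thesis
        using d_minimal[of "pt \<one>\<^bsub>L\<^esub> b"] b by (simp add: exp_deg_pt)
    qed
    show "nonzero_divisor A (\<sigma> s d)"
      unfolding nonzero_divisor_def
    proof (intro conjI ballI impI)
      fix b assume b: "b \<in> carrier A" "\<sigma> s d \<otimes>\<^bsub>A\<^esub> b = \<zero>\<^bsub>A\<^esub>"
      then have "\<sigma>' ?s d \<otimes>\<^bsub>LA\<^esub> pt \<one>\<^bsub>L\<^esub> b = \<zero>\<^bsub>LA\<^esub>"
        using s by (simp add: sigma'_pt pt_mult pt_zero_right)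
      then show "b = \<zero>\<^bsub>A\<^esub>"
        using B.c_cancel[of "pt \<one>\<^bsub>L\<^esub> b"] b by (simp add: pt_inj)
    qed (use s in simp)
  qed (use s \<open>d > 0\<close> in auto)

  interpret I: cring ?I
    by (rule LA.invariant_ring_cring)
  have p: "p i \<in> exp_invariants LA \<sigma>'" if "i \<in> {1..l}" for i
    using assms(10) that by auto
  have c_eq: "\<sigma>' ?s d = finprod LA p {1..l}"
    using assms(11) s by (simp add: sigma'_pt lc)
  have p_cancel: "b \<in> B.Inv_s" if i: "i \<in> {1..l}" and b: "b \<in> carrier LA" "p i \<otimes>\<^bsub>LA\<^esub> b \<in> B.Inv_s" for i b
  proof (rule B.factor_cancel[OF ac.algebraically_closed_axioms pt_left_hom p[OF i] _ _ _ _ b])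
    show nz: "y = \<zero>\<^bsub>LA\<^esub>" if y: "y \<in> carrier LA" "p i \<otimes>\<^bsub>LA\<^esub> y = \<zero>\<^bsub>LA\<^esub>" for y
    proof -
      \<comment> \<open>The cofactor of \<open>p i\<close> in the leading coefficient: a factor of a
        nonzero divisor is itself a nonzero divisor.\<close>
      define q where "q = finprod LA p ({1..l} - {i})"
      have q: "q \<in> carrier LA"
        unfolding q_def using p by (intro LA.finprod_closed) auto
      have "\<sigma>' ?s d = finprod LA p (insert i ({1..l} - {i}))"
        using i by (simp add: c_eq insert_absorb)
      also have "\<dots> = p i \<otimes>\<^bsub>LA\<^esub> q"
        unfolding q_def using p i by (subst LA.finprod_insert) auto
      finally have "\<sigma>' ?s d \<otimes>\<^bsub>LA\<^esub> y = q \<otimes>\<^bsub>LA\<^esub> (p i \<otimes>\<^bsub>LA\<^esub> y)"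
        using p[OF i] q y(1) by (simp add: LA.m_comm[of _ q] LA.m_assoc)
      then show ?thesis
        using B.c_cancel y q by simp
    qed
    show prime: "primeideal (PIdl\<^bsub>LA\<^esub> p i) LA"
      using LA.quot_domain_imp_primeideal[OF LA.cgenideal_ideal] p[OF i] assms(13)[OF i] by simp
    show "\<exists>\<mu>\<in>carrier L. \<exists>a'\<in>exp_invariants LA \<sigma>'. a = pt \<mu> \<one>\<^bsub>A\<^esub> \<oplus>\<^bsub>LA\<^esub> p i \<otimes>\<^bsub>LA\<^esub> a'"
      if a: "a \<in> exp_invariants LA \<sigma>'" for a
    proof -
      let ?P = "PIdl\<^bsub>?I\<^esub> p i"
      have ideal: "ideal ?P ?I"
        using I.cgenideal_ideal p[OF i] by simp
      interpret P: ideal ?P ?I by (rule ideal)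
      \<comment> \<open>Surjectivity of the residue map: every invariant is congruent to a constant
        modulo \<open>p i\<close>.\<close>
      have "(\<lambda>c. ?P +>\<^bsub>?I\<^esub> pt c \<one>\<^bsub>A\<^esub>) ` carrier L = carrier (?I Quot ?P)"
        using assms(12)[OF i] by (simp add: ring_iso_def bij_betw_def)
      moreover have "?P +>\<^bsub>?I\<^esub> a \<in> carrier (?I Quot ?P)"
        using P.rcos_ring_hom a by (auto simp: ring_hom_def)
      ultimately have "?P +>\<^bsub>?I\<^esub> a \<in> (\<lambda>c. ?P +>\<^bsub>?I\<^esub> pt c \<one>\<^bsub>A\<^esub>) ` carrier L"
        by simp
      then obtain \<mu> where \<mu>: "\<mu> \<in> carrier L" "?P +>\<^bsub>?I\<^esub> a = ?P +>\<^bsub>?I\<^esub> pt \<mu> \<one>\<^bsub>A\<^esub>"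
        by blast
      moreover have "a \<in> ?P +>\<^bsub>?I\<^esub> a"
        using P.a_rcos_self a by simp
      ultimately obtain z where "z \<in> ?P" "a = z \<oplus>\<^bsub>LA\<^esub> pt \<mu> \<one>\<^bsub>A\<^esub>"
        by (auto simp: a_r_coset_def')
      moreover then obtain a' where "a' \<in> exp_invariants LA \<sigma>'" "z = a' \<otimes>\<^bsub>LA\<^esub> p i"
        by (auto simp: cgenideal_def)
      ultimately have "a' \<in> exp_invariants LA \<sigma>'" "a = pt \<mu> \<one>\<^bsub>A\<^esub> \<oplus>\<^bsub>LA\<^esub> p i \<otimes>\<^bsub>LA\<^esub> a'"
        using \<mu>(1) p[OF i] by (simp_all add: LA.a_comm LA.m_comm)
      then show ?thesis
        using \<mu>(1) by blast
    qed
    show "?s \<ominus>\<^bsub>LA\<^esub> pt \<mu> \<one>\<^bsub>A\<^esub> \<notin> PIdl\<^bsub>LA\<^esub> p i" if "\<mu> \<in> carrier L" for \<mu>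
      using assms(8) primeideal.I_notcarr[OF prime] pt_const_invariant[OF that]
      by (intro B.root_not_in_factor[OF _ d_LA p[OF i] nz]) auto
  qed
  \<comment> \<open>Subproducts over arbitrary \<open>J\<close> allow the factors to be removed one
    at a time. The empty product covers \<open>l = 0\<close>.\<close>
  have prod_cancel: "b \<in> B.Inv_s"
    if "finite J" "J \<subseteq> {1..l}" "b \<in> carrier LA" "finprod LA p J \<otimes>\<^bsub>LA\<^esub> b \<in> B.Inv_s" for J b
    using that
  proof (induction J arbitrary: b rule: finite_induct)
    case (insert i J)
    have i: "i \<in> {1..l}" "J \<subseteq> {1..l}"
      using insert.prems(1) by auto
    have car: "finprod LA p J \<in> carrier LA" "p i \<in> carrier LA" "p \<in> J \<rightarrow> carrier LA"
      using p i by (auto intro!: LA.finprod_closed)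
    then have "finprod LA p (insert i J) \<otimes>\<^bsub>LA\<^esub> b = p i \<otimes>\<^bsub>LA\<^esub> (finprod LA p J \<otimes>\<^bsub>LA\<^esub> b)"
      using insert.prems(2) insert.hyps by (simp add: LA.m_assoc)
    then have "p i \<otimes>\<^bsub>LA\<^esub> (finprod LA p J \<otimes>\<^bsub>LA\<^esub> b) \<in> B.Inv_s"
      using insert.prems(3) by simp
    then have "finprod LA p J \<otimes>\<^bsub>LA\<^esub> b \<in> B.Inv_s"
      by (rule p_cancel[OF i(1) LA.m_closed[OF car(1) insert.prems(2)]])
    then show ?case
      by (rule insert.IH[OF i(2) insert.prems(2)])
  qed simp
  have c_cancel: "b \<in> B.Inv_s"
    if "b \<in> carrier LA" "\<sigma>' ?s d [^]\<^bsub>LA\<^esub> n \<otimes>\<^bsub>LA\<^esub> b \<in> B.Inv_s" for b and n :: nat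
    using that
  proof (induction n)
    case (Suc n)
    have "\<sigma>' ?s d \<otimes>\<^bsub>LA\<^esub> (\<sigma>' ?s d [^]\<^bsub>LA\<^esub> n \<otimes>\<^bsub>LA\<^esub> b) \<in> B.Inv_s"
      using Suc.prems LA.m_assoc[of "\<sigma>' ?s d [^]\<^bsub>LA\<^esub> n" "\<sigma>' ?s d" b]
        LA.m_lcomm[of "\<sigma>' ?s d" "\<sigma>' ?s d [^]\<^bsub>LA\<^esub> n" b] by simp
    then have "\<sigma>' ?s d [^]\<^bsub>LA\<^esub> n \<otimes>\<^bsub>LA\<^esub> b \<in> B.Inv_s"
      using prod_cancel[of "{1..l}" "\<sigma>' ?s d [^]\<^bsub>LA\<^esub> n \<otimes>\<^bsub>LA\<^esub> b", folded c_eq]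
        Suc.prems(1) s by simp
    then show ?case
      by (rule Suc.IH[OF Suc.prems(1)])
  qed simp

  obtain \<Phi> where \<Phi>: "\<And>x. x \<in> carrier LA \<Longrightarrow> \<Phi> x \<in> carrier A"
    "\<And>x y. x \<in> carrier LA \<Longrightarrow> y \<in> carrier LA \<Longrightarrow> \<Phi> (x \<oplus>\<^bsub>LA\<^esub> y) = \<Phi> x \<oplus>\<^bsub>A\<^esub> \<Phi> y"
    "\<And>x a. x \<in> carrier LA \<Longrightarrow> a \<in> carrier A \<Longrightarrow> \<Phi> (x \<otimes>\<^bsub>LA\<^esub> pt \<one>\<^bsub>L\<^esub> a) = \<Phi> x \<otimes>\<^bsub>A\<^esub> a"
    "\<And>a. a \<in> carrier A \<Longrightarrow> \<Phi> (pt \<one>\<^bsub>L\<^esub> a) = a"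
    "\<And>x i. x \<in> carrier LA \<Longrightarrow> \<Phi> (\<sigma>' x i) = \<sigma> (\<Phi> x) i"
    by (rule retraction) blast
  have \<Phi>_zero: "\<Phi> \<zero>\<^bsub>LA\<^esub> = \<zero>\<^bsub>A\<^esub>"
    using \<Phi>(4)[of "\<zero>\<^bsub>A\<^esub>"] by (simp add: pt_zero_right)
  have \<Phi>_inv: "\<Phi> k \<in> exp_invariants A \<sigma>" if k: "k \<in> exp_invariants LA \<sigma>'" for k
  proof -
    have "\<sigma> (\<Phi> k) i = \<zero>\<^bsub>A\<^esub>" if "i > 0" for i
      using \<Phi>(5)[of k i] LA.invariantD[OF k that] k \<Phi>_zero by simp
    then show ?thesis
      using \<Phi>(1) k by (simp add: S.invariant_iff del: S.invariant_closed)
  qed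
  \<comment> \<open>\<Phi> respects the Horner form: it is linear over \<open>A\<close>, in
    particular for multiplication by \<open>s\<close>, and maps the coefficients to invariants of
    \<sigma>.\<close>
  have \<Phi>_Inv_s: "\<Phi> x \<in> A.Inv_s" if "x \<in> B.Inv_s" for x
    using that
  proof (induction x rule: LA.simple_extension.induct)
    case (lin x k)
    then have "\<Phi> (x \<otimes>\<^bsub>LA\<^esub> ?s \<oplus>\<^bsub>LA\<^esub> k) = \<Phi> x \<otimes>\<^bsub>A\<^esub> s \<oplus>\<^bsub>A\<^esub> \<Phi> k"
      using B.Inv_s_closed s by (simp add: \<Phi>)
    then show ?case
      using A.simple_extension.lin[OF lin.IH \<Phi>_inv[OF lin.hyps(2)]] by simp
  qed (simp add: \<Phi>_zero)
  \<comment> \<open>Over the base change, some power of the leading coefficient moves the image of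
    \<open>a\<close> into \<open>B.Inv_s\<close> and is cancelled there; \<Phi> then returns
    \<open>a\<close> itself.\<close>
  have "a \<in> A.Inv_s" if a: "a \<in> carrier A" for a
  proof -
    have "pt \<one>\<^bsub>L\<^esub> a \<in> B.Inv_s"
      using B.c_pow_mult_mem[of "pt \<one>\<^bsub>L\<^esub> a"] c_cancel[of "pt \<one>\<^bsub>L\<^esub> a"] a by auto
    then show ?thesis
      using \<Phi>_Inv_s \<Phi>(4)[OF a] by metis
  qed
  then have "A.Inv_s = carrier A"
    using A.Inv_s_closed by blast
  then show ?thesis
    using A.s_transcendental s by (simp add: is_polynomial_ring_in_def)
qed

end
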